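(* Let $m\ge1$ be an integer, let $\alpha,\beta\ge 1$, and put $$R=\max\left\{\alpha\left(1+\tfrac1\beta\right),\ 1+\tfrac1\alpha+\tfrac1\beta+\tfrac1{\alpha\beta},\ \beta,\ 2,\ 1+\tfrac2\alpha\right\},\qquad r=\max\left\{\alpha,\ 1+\tfrac1\alpha\right\}.$$ If $R\le 2r$, then there is a (deterministic) online algorithm for scheduling with uncertain processing times on $m$ machines, with the objective of minimizing the total completion time, that is $\left(R\left(\tfrac12+\tfrac1{2m}\right)+r\left(1-\tfrac1m\right)\right)$-competitive.
   Context: Problem. There are $n$ jobs, all available at time $0$, and $m$ identical machines, each of which runs one task at a time. Job $j$ has a testing time $t_j\ge 0$, an upper limit $u_j\ge 0$, and a real processing time $p_j\in[0,u_j]$. A job may be executed untested, which takes $u_j$ time units, or it may be tested (taking $t_j$ time units) and afterwards, once the test is finished, executed in $p_j$ time units; other tasks may run between the test and the execution, and the test and the execution of a job may be on different machines. The completion time of a job is the time at which its execution (or execution-untested) ends, and the cost of a schedule is the sum of the completion times of all jobs. An online algorithm knows all $t_j,u_j$ from the start, but learns $p_j$ only when the test of $j$ is finished. $\mathrm{OPT}$ knows all $p_j$ in advance (but must still test $j$ in order to run it in time $p_j$), and its cost is the minimum cost of any schedule; it spends $\min\{u_j,t_j+p_j\}$ on job $j$ and runs jobs in non-decreasing order of this quantity whenever a machine is available. An algorithm $A$ is $c$-competitive if $\mathrm{cost}(A)\le c\cdot\mathrm{cost}(\mathrm{OPT})$ on all instances. *)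

theory Defs
  imports Complex_Main
begin

text \<open>
  Jobs are \<open>0, \<dots>, n - 1\<close> and machines are \<open>0, \<dots>, m - 1\<close>.  The first record is the part of an
  instance that an online algorithm knows from the start.
\<close>

record public_data =
  num_jobs :: nat
  test_time :: "nat \<Rightarrow> real"
  upper_limit :: "nat \<Rightarrow> real"

record problem = public_data +
  proc_time :: "nat \<Rightarrow> real"

definition valid_problem :: "problem \<Rightarrow> bool" where
  "valid_problem I \<longleftrightarrow> (\<forall>j < num_jobs I.
     0 \<le> test_time I j \<and> 0 \<le> upper_limit I j \<and>
     0 \<le> proc_time I j \<and> proc_time I j \<le> upper_limit I j)"

text \<open>
  \<open>Exec_Tested j\<close> is the execution of \<open>j\<close> after its test, \<open>Exec_Untested j\<close> the execution of \<open>j\<close>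
  without a test.
\<close>

datatype task = Test nat | Exec_Tested nat | Exec_Untested nat

fun job_of :: "task \<Rightarrow> nat" where
  "job_of (Test j) = j"
| "job_of (Exec_Tested j) = j"
| "job_of (Exec_Untested j) = j"

fun duration :: "problem \<Rightarrow> task \<Rightarrow> real" where
  "duration I (Test j) = test_time I j"
| "duration I (Exec_Tested j) = proc_time I j"
| "duration I (Exec_Untested j) = upper_limit I j"

text \<open>
  A schedule maps each task that is carried out to its starting time and its machine.
\<close>

type_synonym schedule = "task \<Rightarrow> (real \<times> nat) option"

definition runs_untested :: "schedule \<Rightarrow> nat \<Rightarrow> bool" where
  "runs_untested S j \<longleftrightarrow>
     S (Exec_Untested j) \<noteq> None \<and> S (Test j) = None \<and> S (Exec_Tested j) = None"

definition runs_tested :: "problem \<Rightarrow> schedule \<Rightarrow> nat \<Rightarrow> bool" where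
  "runs_tested I S j \<longleftrightarrow> S (Exec_Untested j) = None \<and>
     (\<exists>s i s' i'. S (Test j) = Some (s, i) \<and> S (Exec_Tested j) = Some (s', i') \<and>
        s + test_time I j \<le> s')"

text \<open>
  Two tasks on one machine must be ordered one after the other.  A task of length zero may thus
  start at an endpoint of another task, but not strictly inside it.
\<close>

definition feasible :: "nat \<Rightarrow> problem \<Rightarrow> schedule \<Rightarrow> bool" where
  "feasible m I S \<longleftrightarrow>
     (\<forall>k s i. S k = Some (s, i) \<longrightarrow> job_of k < num_jobs I \<and> 0 \<le> s \<and> i < m) \<and>
     (\<forall>k k' s s' i. k \<noteq> k' \<and> S k = Some (s, i) \<and> S k' = Some (s', i) \<longrightarrow>
        s + duration I k \<le> s' \<or> s' + duration I k' \<le> s) \<and>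
     (\<forall>j < num_jobs I. runs_untested S j \<or> runs_tested I S j)"

definition completion_time :: "problem \<Rightarrow> schedule \<Rightarrow> nat \<Rightarrow> real" where
  "completion_time I S j =
     (case S (Exec_Untested j) of
        Some (s, i) \<Rightarrow> s + upper_limit I j
      | None \<Rightarrow> fst (the (S (Exec_Tested j))) + proc_time I j)"

definition cost :: "problem \<Rightarrow> schedule \<Rightarrow> real" where
  "cost I S = (\<Sum>j < num_jobs I. completion_time I S j)"

definition opt_cost :: "nat \<Rightarrow> problem \<Rightarrow> real" where
  "opt_cost m I = Inf {cost I S | S. feasible m I S}"

text \<open>
  An online algorithm is a deterministic policy.  It is consulted with the public data, the tasks
  started so far, the current time, and the processing times revealed so far; it either starts a
  task now, or waits until a given time, in which case it is consulted again already when a test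
  finishes, should this happen earlier.  It needs no further memory: the public data, the partial
  schedule and the revealed processing times determine all its previous decisions.
\<close>

datatype decision = Start task nat | Wait real

type_synonym algorithm =
  "public_data \<Rightarrow> schedule \<Rightarrow> real \<Rightarrow> (nat \<Rightarrow> real option) \<Rightarrow> decision"

definition revealed :: "problem \<Rightarrow> schedule \<Rightarrow> real \<Rightarrow> nat \<Rightarrow> real option" where
  "revealed I S now j =
     (if \<exists>s i. S (Test j) = Some (s, i) \<and> s + test_time I j \<le> now
      then Some (proc_time I j) else None)"

definition pending_tests :: "problem \<Rightarrow> schedule \<Rightarrow> real \<Rightarrow> real set" where
  "pending_tests I S now =
     {s + test_time I j | j s i. S (Test j) = Some (s, i) \<and> now < s + test_time I j}"

text \<open>
  Starting a task twice, or waiting for a time that is not in the future, leaves the state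
  unchanged, so that the (deterministic) run is stuck from then on.
\<close>

definition step :: "algorithm \<Rightarrow> problem \<Rightarrow> schedule \<times> real \<Rightarrow> schedule \<times> real" where
  "step A I = (\<lambda>(S, now).
     case A (public_data.truncate I) S now (revealed I S now) of
       Start k i \<Rightarrow> (if S k = None then S(k \<mapsto> (now, i)) else S, now)
     | Wait w \<Rightarrow> (S, Min (insert (max now w) (pending_tests I S now))))"

definition run :: "algorithm \<Rightarrow> problem \<Rightarrow> nat \<Rightarrow> schedule \<times> real" where
  "run A I N = (step A I ^^ N) (Map.empty, 0)"

text \<open>
  A feasible schedule contains an execution of every job and cannot be properly extended to a
  feasible schedule, so there is at most one schedule that a policy produces on an instance.
  Starting a task on a busy machine, an execution before the end of the corresponding test, and
  the like, can never be repaired later and result in no schedule being produced.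
\<close>

definition produces :: "nat \<Rightarrow> algorithm \<Rightarrow> problem \<Rightarrow> schedule \<Rightarrow> bool" where
  "produces m A I S \<longleftrightarrow> feasible m I S \<and> (\<exists>N. fst (run A I N) = S)"

definition online_algorithm :: "nat \<Rightarrow> algorithm \<Rightarrow> bool" where
  "online_algorithm m A \<longleftrightarrow> (\<forall>I. valid_problem I \<longrightarrow> (\<exists>S. produces m A I S))"

definition competitive :: "nat \<Rightarrow> algorithm \<Rightarrow> real \<Rightarrow> bool" where
  "competitive m A c \<longleftrightarrow>
     (\<forall>I S. valid_problem I \<longrightarrow> produces m A I S \<longrightarrow> cost I S \<le> c * opt_cost m I)"

lemma feasible_maximal:
  assumes S: "feasible m I S" and S': "feasible m I S'" and sub: "S \<subseteq>\<^sub>m S'"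
  shows "S = S'"
proof (rule map_le_antisym[OF sub])
  have "S k = S' k" if k: "S' k \<noteq> None" for k
  proof -
    obtain s i where "S' k = Some (s, i)" using k by auto
    then have j: "job_of k < num_jobs I" using S' unfolding feasible_def by blast
    have 1: "runs_untested S (job_of k) \<or> runs_tested I S (job_of k)"
      and 2: "runs_untested S' (job_of k) \<or> runs_tested I S' (job_of k)"
      using S S' j unfolding feasible_def by blast+
    have eq: "S l = S' l" if "S l \<noteq> None" for l
      using sub that by (auto simp: map_le_def dom_def)
    show ?thesis
      using 1 2 k eq[of k] eq[of "Exec_Untested (job_of k)"] eq[of "Test (job_of k)"]
      by (cases k) (auto simp: runs_untested_def runs_tested_def)
  qed
  then show "S' \<subseteq>\<^sub>m S" by (auto simp: map_le_def dom_def)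
qed

lemma run_mono: "N \<le> N' \<Longrightarrow> fst (run A I N) \<subseteq>\<^sub>m fst (run A I N')"
proof (induction N' rule: dec_induct)
  case (step N')
  have "fst (run A I N') \<subseteq>\<^sub>m fst (run A I (Suc N'))"
    by (auto simp: run_def step_def map_le_def split: prod.splits decision.splits)
  with step.IH show ?case by (rule map_le_trans)
qed simp

lemma produces_unique:
  assumes "produces m A I S" "produces m A I S'"
  shows "S = S'"
proof -
  obtain N N' where "fst (run A I N) = S" "fst (run A I N') = S'"
    using assms unfolding produces_def by blast
  then have "S \<subseteq>\<^sub>m S' \<or> S' \<subseteq>\<^sub>m S"
    using run_mono[of N N' A I] run_mono[of N' N A I] by (metis nle_le)
  then show ?thesis using feasible_maximal assms unfolding produces_def by metis
qed

lemma cost_nonneg: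
  assumes "valid_problem I" "feasible m I S"
  shows "0 \<le> cost I S"
  unfolding cost_def
proof (rule sum_nonneg)
  fix j assume "j \<in> {..<num_jobs I}"
  then have j: "j < num_jobs I" by simp
  have "runs_untested S j \<or> runs_tested I S j" using assms(2) j unfolding feasible_def by blast
  moreover have "0 \<le> s" if "S k = Some (s, i)" for k s i
    using assms(2) that unfolding feasible_def by blast
  ultimately show "0 \<le> completion_time I S j"
    using assms(1) j
    by (fastforce simp: completion_time_def runs_untested_def runs_tested_def valid_problem_def
        split: option.splits)
qed

lemma feasible_exists:
  assumes "valid_problem I" "1 \<le> m"
  shows "\<exists>S. feasible m I S"
proof -
  define f where "f j = (\<Sum>i<j. upper_limit I i)" for j
  define S :: schedule where
    "S k = (case k of Exec_Untested j \<Rightarrow> if j < num_jobs I then Some (f j, 0) else None | _ \<Rightarrow> None)"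
    for k
  have u: "0 \<le> upper_limit I j" if "j < num_jobs I" for j
    using assms(1) that by (auto simp: valid_problem_def)
  have f0: "0 \<le> f j" if "j < num_jobs I" for j
    unfolding f_def using that by (intro sum_nonneg u) auto
  have f1: "f a + upper_limit I a \<le> f b" if "a < b" "b < num_jobs I" for a b
  proof -
    have "f a + upper_limit I a = f (Suc a)" by (simp add: f_def)
    also have "\<dots> \<le> f b" unfolding f_def using that by (intro sum_mono2 u) auto
    finally show ?thesis .
  qed
  have "feasible m I S"
    unfolding feasible_def
  proof (intro conjI allI impI)
    fix k s i assume "S k = Some (s, i)"
    then show "job_of k < num_jobs I" "0 \<le> s" "i < m"
      using f0 assms(2) by (auto simp: S_def split: task.splits if_splits)
  next
    fix k k' s s' i
    assume "k \<noteq> k' \<and> S k = Some (s, i) \<and> S k' = Some (s', i)"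
    then obtain a b where "a \<noteq> b" "k = Exec_Untested a" "k' = Exec_Untested b"
      "a < num_jobs I" "b < num_jobs I" "s = f a" "s' = f b"
      by (auto simp: S_def split: task.splits if_splits)
    then show "s + duration I k \<le> s' \<or> s' + duration I k' \<le> s"
      using f1[of a b] f1[of b a] by (cases "a < b") auto
  next
    fix j assume "j < num_jobs I"
    then show "runs_untested S j \<or> runs_tested I S j"
      by (auto simp: runs_untested_def S_def)
  qed
  then show ?thesis by blast
qed

lemma opt_cost_le:
  assumes "valid_problem I" "feasible m I S"
  shows "opt_cost m I \<le> cost I S"
  unfolding opt_cost_def using assms
  by (intro cInf_lower bdd_belowI[where m = 0]) (auto intro: cost_nonneg)

end

theory Submission
  imports Defs "HOL-Analysis.Lebesgue_Measure"
begin

text \<open>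
  Let \<open>q\<^sub>j = min {u\<^sub>j, t\<^sub>j + p\<^sub>j}\<close>.  The algorithm tests \<open>j\<close> iff \<open>u\<^sub>j > \<alpha> t\<^sub>j\<close> and always starts, on a free
  machine, the available task of least weight, where a test weighs \<open>\<beta> t\<^sub>j\<close>, an untested execution
  \<open>u\<^sub>j\<close>, and a tested execution \<open>max {\<beta> t\<^sub>j, t\<^sub>j + p\<^sub>j}\<close>; ties are broken by the job index.  It spends
  at most \<open>r q\<^sub>j\<close> on \<open>j\<close>.  While \<open>j\<close> is waiting, all machines are busy with tasks that precede its
  final task, and a case distinction bounds the amount by which two jobs \<open>i\<close> and \<open>j\<close> delay each
  other by \<open>R min {q\<^sub>i, q\<^sub>j}\<close>.  With \<open>Q = \<Sum>\<^sub>j q\<^sub>j\<close> and \<open>M = \<Sum>\<^sub>i\<Sum>\<^sub>j min {q\<^sub>i, q\<^sub>j}\<close>, the cost is therefore at most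
  \<open>R (M - Q) / (2 m) + r Q\<close>.

  On the other side, \<open>OPT \<ge> M / (2 m) + Q / 2\<close> (Eastman, Even and Isaacs) and \<open>OPT \<ge> Q\<close>.  For a
  schedule that spends \<open>D\<^sub>j\<close> on \<open>j\<close>, the loads of the machines give
  \<open>\<Sum>\<^sub>j D\<^sub>j C\<^sub>j \<ge> (\<Sum>\<^sub>j D\<^sub>j)\<^sup>2 / (2 m) + \<Sum>\<^sub>j D\<^sub>j\<^sup>2 / 2\<close> for every set of jobs, and Abel summation along
  increasing \<open>D\<^sub>j\<close> removes the weights \<open>D\<^sub>j\<close>.
\<close>

subsection \<open>A lower bound on the cost of feasible schedules\<close>

text \<open>Tasks are added in order of their starting times. The first claim is what the second one
  needs: a new task of positive length starts no earlier than the total length of the tasks before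
  it. Without idle time the second claim is an equality.\<close>

lemma machine_work:
  fixes s d :: "'a \<Rightarrow> real"
  assumes "finite K" and "\<And>k. k \<in> K \<Longrightarrow> 0 \<le> s k" and "\<And>k. k \<in> K \<Longrightarrow> 0 \<le> d k"
    and "\<And>k k'. \<lbrakk>k \<in> K; k' \<in> K; k \<noteq> k'\<rbrakk> \<Longrightarrow> s k + d k \<le> s k' \<or> s k' + d k' \<le> s k"
  shows "(\<forall>T\<ge>0. (\<forall>k\<in>K. s k + d k \<le> T) \<longrightarrow> sum d K \<le> T) \<and>
    (sum d K)\<^sup>2 + (\<Sum>k\<in>K. (d k)\<^sup>2) \<le> 2 * (\<Sum>k\<in>K. d k * (s k + d k))"
  using assms
proof (induction K rule: finite_ranking_induct[where f = s])
  case empty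
  then show ?case by simp
next
  case (insert x K)
  have IH: "(\<forall>T\<ge>0. (\<forall>k\<in>K. s k + d k \<le> T) \<longrightarrow> sum d K \<le> T) \<and>
    (sum d K)\<^sup>2 + (\<Sum>k\<in>K. (d k)\<^sup>2) \<le> 2 * (\<Sum>k\<in>K. d k * (s k + d k))"
    using insert.prems by (intro insert.IH) auto
  show ?case
  \<comment> \<open>A task of length zero may share its starting time with a longer task, so the
    other tasks need not end before it starts; it adds nothing to any of the sums, however.\<close>
  proof (cases "x \<in> K \<or> d x = 0")
    case True
    then show ?thesis
      using IH insert.hyps(1) by (cases "x \<in> K") (auto simp: insert_absorb)
  next
    case False
    with insert.prems(2) have dx: "d x > 0" by fastforce
    have "s k + d k \<le> s x" if "k \<in> K" for k
      using insert.prems(3)[of k x] insert.hyps(2)[OF that] that dx False by auto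
    then have sx: "sum d K \<le> s x" using IH insert.prems(1) by auto
    have "2 * d x * sum d K \<le> 2 * d x * s x" using sx dx by simp
    with IH insert.hyps(1) False sx show ?thesis
      by (auto simp: power2_eq_square algebra_simps)
  qed
qed

section \<open>Tasks, jobs and completion times weighted by work\<close>

definition start :: "schedule \<Rightarrow> task \<Rightarrow> real" where "start S k = fst (the (S k))"

definition machine :: "schedule \<Rightarrow> task \<Rightarrow> nat" where "machine S k = snd (the (S k))"

definition job_tasks :: "schedule \<Rightarrow> nat \<Rightarrow> task set" where
  "job_tasks S j = {k \<in> dom S. job_of k = j}"

definition work :: "problem \<Rightarrow> schedule \<Rightarrow> nat \<Rightarrow> real" where
  "work I S j = sum (duration I) (job_tasks S j)"

definition opt_time :: "problem \<Rightarrow> nat \<Rightarrow> real" where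
  "opt_time I j = min (upper_limit I j) (test_time I j + proc_time I j)"

lemma dom_start: "k \<in> dom S \<longleftrightarrow> S k = Some (start S k, machine S k)"
  by (auto simp: start_def machine_def)

lemma finite_tasks: "finite {k. job_of k < n}"
proof -
  have "{k. job_of k < n} \<subseteq> Test ` {..<n} \<union> Exec_Tested ` {..<n} \<union> Exec_Untested ` {..<n}"
  proof
    fix k assume "k \<in> {k. job_of k < n}"
    then show "k \<in> Test ` {..<n} \<union> Exec_Tested ` {..<n} \<union> Exec_Untested ` {..<n}"
      by (cases k) auto
  qed
  then show ?thesis by (rule finite_subset) auto
qed

lemma feasible_finite_dom:
  assumes "feasible m I S" shows "finite (dom S)"
  by (rule finite_subset[OF _ finite_tasks[of "num_jobs I"]])
    (use assms in \<open>auto simp: feasible_def\<close>)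

lemma duration_nonneg:
  assumes "valid_problem I" "job_of k < num_jobs I" shows "0 \<le> duration I k"
  using assms by (cases k) (auto simp: valid_problem_def)

lemma job_tasks_untested:
  assumes "runs_untested S j" shows "job_tasks S j = {Exec_Untested j}"
proof -
  have "k \<in> job_tasks S j \<longleftrightarrow> k = Exec_Untested j" for k
    using assms by (cases k) (auto simp: job_tasks_def runs_untested_def)
  then show ?thesis by auto
qed

lemma job_tasks_tested:
  assumes "runs_tested I S j" shows "job_tasks S j = {Test j, Exec_Tested j}"
proof -
  have "k \<in> job_tasks S j \<longleftrightarrow> k = Test j \<or> k = Exec_Tested j" for k
    using assms by (cases k) (auto simp: job_tasks_def runs_tested_def)
  then show ?thesis by auto
qed

text \<open>The last inequality lets a tested job be treated as a single block of length
  \<open>work\<close> that ends at the completion time: the products of testing and processing time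
  cancel, and what remains is that the execution starts no earlier than the end of the test.\<close>

lemma job_work:
  assumes I: "valid_problem I" and S: "feasible m I S" and j: "j < num_jobs I"
  shows "opt_time I j \<le> work I S j" and "0 \<le> work I S j" and "work I S j \<le> completion_time I S j"
    and "(\<Sum>k\<in>job_tasks S j. 2 * (duration I k * (start S k + duration I k)) - (duration I k)\<^sup>2)
      \<le> 2 * (work I S j * completion_time I S j) - (work I S j)\<^sup>2"
proof -
  have "runs_untested S j \<or> runs_tested I S j" using S j by (auto simp: feasible_def)
  moreover have nn: "0 \<le> s" if "S k = Some (s, i)" for k s i
    using S that by (auto simp: feasible_def)
  moreover have v: "0 \<le> test_time I j" "0 \<le> upper_limit I j" "0 \<le> proc_time I j"
    using I j by (auto simp: valid_problem_def)
  ultimately have "opt_time I j \<le> work I S j \<and> 0 \<le> work I S j \<and>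
    work I S j \<le> completion_time I S j \<and>
    (\<Sum>k\<in>job_tasks S j. 2 * (duration I k * (start S k + duration I k)) - (duration I k)\<^sup>2)
      \<le> 2 * (work I S j * completion_time I S j) - (work I S j)\<^sup>2"
  proof (elim disjE)
    assume u: "runs_untested S j"
    then obtain s i where "S (Exec_Untested j) = Some (s, i)" by (auto simp: runs_untested_def)
    then show ?thesis using nn v unfolding work_def opt_time_def completion_time_def
      job_tasks_untested[OF u] start_def by auto
  next
    assume u: "runs_tested I S j"
    then obtain s i s' i' where *: "S (Exec_Untested j) = None" "S (Test j) = Some (s, i)"
      "S (Exec_Tested j) = Some (s', i')" "s + test_time I j \<le> s'"
      by (auto simp: runs_tested_def)
    have "test_time I j * (s + test_time I j) \<le> test_time I j * s'"
      using * v by (intro mult_left_mono) auto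
    then show ?thesis using nn[OF *(2)] * v
      unfolding work_def opt_time_def completion_time_def
      job_tasks_tested[OF u] start_def by (auto simp: power2_eq_square algebra_simps)
  qed
  then show "opt_time I j \<le> work I S j" "0 \<le> work I S j" "work I S j \<le> completion_time I S j"
    "(\<Sum>k\<in>job_tasks S j. 2 * (duration I k * (start S k + duration I k)) - (duration I k)\<^sup>2)
      \<le> 2 * (work I S j * completion_time I S j) - (work I S j)\<^sup>2" by auto
qed

text \<open>\<open>machine_work\<close> is summed over the machines, with Cauchy-Schwarz for the
  squared loads, and the result is regrouped by job. The set \<open>J\<close> is arbitrary because
  the Abel summation applies the bound to initial segments of the jobs sorted by work.\<close>

lemma weighted_completion_bound:
  assumes I: "valid_problem I" and S: "feasible m I S" and J: "J \<subseteq> {..<num_jobs I}" and m: "m \<ge> 1"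
  shows "(\<Sum>j\<in>J. work I S j)\<^sup>2 / m + (\<Sum>j\<in>J. (work I S j)\<^sup>2)
    \<le> 2 * (\<Sum>j\<in>J. work I S j * completion_time I S j)"
proof -
  define K where "K = {k \<in> dom S. job_of k \<in> J}"
  define d where "d = duration I"
  define L where "L i = sum d {k \<in> K. machine S k = i}" for i
  have finJ: "finite J" using J finite_subset by blast
  have finK: "finite K" using feasible_finite_dom[OF S] by (simp add: K_def)
  have K: "S k = Some (start S k, machine S k)" "0 \<le> start S k" "0 \<le> d k" "machine S k < m"
    if "k \<in> K" for k
  proof -
    show *: "S k = Some (start S k, machine S k)" using that by (auto simp: K_def dom_start)
    then show "0 \<le> start S k" "machine S k < m" "0 \<le> d k"
      using S I by (auto simp: feasible_def d_def intro!: duration_nonneg)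
  qed
  have by_job: "(\<Sum>j\<in>J. sum f (job_tasks S j)) = sum f K" for f :: "task \<Rightarrow> real"
  proof -
    have "job_tasks S j = {k \<in> K. job_of k = j}" if "j \<in> J" for j
      using that by (auto simp: job_tasks_def K_def)
    then show ?thesis using sum.group[OF finK finJ, of job_of f] by (auto simp: K_def)
  qed
  have by_machine: "(\<Sum>i<m. sum f {k \<in> K. machine S k = i}) = sum f K" for f :: "task \<Rightarrow> real"
    using K finK by (intro sum.group) auto
  have load: "(L i)\<^sup>2 + (\<Sum>k | k \<in> K \<and> machine S k = i. (d k)\<^sup>2)
    \<le> 2 * (\<Sum>k | k \<in> K \<and> machine S k = i. d k * (start S k + d k))" for i
    unfolding L_def
  proof (rule machine_work[THEN conjunct2])
    fix k k' assume kk: "k \<in> {k \<in> K. machine S k = i}" "k' \<in> {k \<in> K. machine S k = i}" "k \<noteq> k'"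
    then have "S k = Some (start S k, i)" "S k' = Some (start S k', i)" using K(1) by auto
    with kk(3) S show "start S k + d k \<le> start S k' \<or> start S k' + d k' \<le> start S k"
      unfolding feasible_def d_def by blast
  qed (use K finK in auto)
  have "(sum d K)\<^sup>2 \<le> m * (\<Sum>i<m. (L i)\<^sup>2)"
    using sum_squared_le_sum_of_squares[of L "{..<m}"] by_machine[of d]
    by (simp add: L_def mult.commute)
  then have "(sum d K)\<^sup>2 / m \<le> (\<Sum>i<m. (L i)\<^sup>2)" using m by (simp add: field_simps)
  also have "\<dots> \<le> (\<Sum>i<m. \<Sum>k | k \<in> K \<and> machine S k = i. 2 * (d k * (start S k + d k)) - (d k)\<^sup>2)"
    using load by (intro sum_mono) (simp add: sum_subtractf sum_distrib_left algebra_simps)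
  also have "\<dots> = (\<Sum>j\<in>J. \<Sum>k\<in>job_tasks S j. 2 * (d k * (start S k + d k)) - (d k)\<^sup>2)"
    by (simp add: by_machine by_job)
  also have "\<dots> \<le> (\<Sum>j\<in>J. 2 * (work I S j * completion_time I S j) - (work I S j)\<^sup>2)"
    unfolding d_def using J by (intro sum_mono job_work(4)[OF I S]) auto
  finally show ?thesis
    using by_job[of d] by (simp add: work_def d_def sum_subtractf sum_distrib_left)
qed

lemma completion_sum_bound:
  fixes D C :: "'a \<Rightarrow> real" and m :: real
  assumes "finite J" and m: "m > 0" and pos: "\<And>j. j \<in> J \<Longrightarrow> 0 < D j"
    and subset: "\<And>J'. J' \<subseteq> J \<Longrightarrow> (sum D J')\<^sup>2 / m + (\<Sum>j\<in>J'. (D j)\<^sup>2) \<le> 2 * (\<Sum>j\<in>J'. D j * C j)"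
  shows "(\<Sum>i\<in>J. \<Sum>j\<in>J. min (D i) (D j)) / m + sum D J \<le> 2 * sum C J"
proof -
  \<comment> \<open>\<open>E\<close> and \<open>F\<close> are the slacks of the weighted and the
    unweighted inequality. A new job \<open>x\<close> of largest \<open>D\<close> changes
    \<open>F\<close> by \<open>\<delta>\<close> and \<open>E\<close> by
    \<open>D x * \<delta>\<close>, so \<open>E J \<le> W * F J\<close> is preserved for
    \<open>W = D x\<close>; since \<open>E\<close> is nonnegative and \<open>D x\<close> positive,
    \<open>F\<close> is nonnegative too.\<close>
  define E where "E J = 2 * (\<Sum>j\<in>J. D j * C j) - (sum D J)\<^sup>2 / m - (\<Sum>j\<in>J. (D j)\<^sup>2)" for J
  define F where "F J = 2 * sum C J - (\<Sum>i\<in>J. \<Sum>j\<in>J. min (D i) (D j)) / m - sum D J" for J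
  have "(\<forall>W. (\<forall>j\<in>J. D j \<le> W) \<longrightarrow> E J \<le> W * F J) \<and> 0 \<le> F J"
    using assms
  proof (induction J rule: finite_ranking_induct[where f = D])
    case empty
    then show ?case by (simp add: E_def F_def)
  next
    case (insert x J)
    show ?case
    proof (cases "x \<in> J")
      case True
      then have "insert x J = J" by blast
      then show ?thesis using insert.IH insert.prems by simp
    next
      case x: False
      define \<delta> where "\<delta> = 2 * C x - (2 * sum D J + D x) / m - D x"
      have "J' \<subseteq> insert x J" if "J' \<subseteq> J" for J' using that by blast
      then have "(\<forall>W. (\<forall>j\<in>J. D j \<le> W) \<longrightarrow> E J \<le> W * F J) \<and> 0 \<le> F J"
        using insert.prems by (intro insert.IH) auto
      then have IH: "E J \<le> D x * F J" using insert.hyps(2) by blast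
      have dx: "D x > 0" using insert.prems by simp
      have min: "min (D x) (D j) = D j" "min (D j) (D x) = D j" if "j \<in> J" for j
        using insert.hyps(2)[OF that] by auto
      have E: "E (insert x J) = E J + D x * \<delta>"
        using x insert.hyps(1) m by (simp add: E_def \<delta>_def power2_eq_square field_simps)
      have F: "F (insert x J) = F J + \<delta>"
        using x insert.hyps(1) m
        by (simp add: F_def \<delta>_def min sum.distrib field_simps)
      have E0: "0 \<le> E (insert x J)"
        using insert.prems(3)[of "insert x J"] by (simp add: E_def)
      have EF: "E (insert x J) \<le> D x * F (insert x J)"
        using IH by (simp add: E F algebra_simps)
      have F0: "0 \<le> F (insert x J)"
        using order_trans[OF E0 EF] dx by (simp add: zero_le_mult_iff)
      \<comment> \<open>Nonnegativity of \<open>F\<close> allows the factor \<open>D x\<close> to be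
        raised to any larger \<open>W\<close>, as the next job requires.\<close>
      have "E (insert x J) \<le> W * F (insert x J)" if "\<forall>j\<in>insert x J. D j \<le> W" for W
        using order_trans[OF EF mult_right_mono[of "D x" W, OF _ F0]] that by simp
      with F0 show ?thesis by blast
    qed
  qed
  then show ?thesis by (simp add: F_def)
qed

text \<open>Any schedule spends at least \<open>opt_time\<close> on each job, so the bounds for the
  actual work \<open>D\<close> carry over to \<open>q\<close> by monotonicity of \<open>min\<close>
  and of the sum.\<close>

lemma cost_lower_bound:
  assumes I: "valid_problem I" and S: "feasible m I S" and m: "m \<ge> 1"
  defines "q \<equiv> opt_time I" and "N \<equiv> {..<num_jobs I}"
  shows "(\<Sum>i\<in>N. \<Sum>j\<in>N. min (q i) (q j)) / m + sum q N \<le> 2 * cost I S" and "sum q N \<le> cost I S"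
proof -
  define D where "D = work I S"
  \<comment> \<open>\<open>completion_sum_bound\<close> cancels factors \<open>D x\<close> and needs
    them positive. Jobs without work contribute nothing to the sums of \<open>D\<close>, and their
    completion times are nonnegative.\<close>
  define J where "J = {j \<in> N. 0 < D j}"
  have qD: "q j \<le> D j" "D j \<le> completion_time I S j" "0 \<le> D j" if "j \<in> N" for j
    using job_work[OF I S] that by (auto simp: q_def D_def N_def)
  have [simp]: "finite N" by (simp add: N_def)
  have JN: "J \<subseteq> N" by (auto simp: J_def)
  have zero: "D j = 0" if "j \<in> N - J" for j using qD(3)[of j] that by (auto simp: J_def)
  have "sum q N \<le> (\<Sum>j\<in>N. completion_time I S j)"
    using qD by (intro sum_mono) (blast intro: order_trans)
  then show "sum q N \<le> cost I S" by (simp add: cost_def N_def)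
  have "(\<Sum>i\<in>N. \<Sum>j\<in>N. min (q i) (q j)) \<le> (\<Sum>i\<in>N. \<Sum>j\<in>N. min (D i) (D j))"
    using qD by (intro sum_mono min.mono)
  also have "\<dots> = (\<Sum>i\<in>J. \<Sum>j\<in>N. min (D i) (D j))"
    using JN zero qD(3) by (intro sum.mono_neutral_right) (auto intro!: sum.neutral)
  also have "\<dots> = (\<Sum>i\<in>J. \<Sum>j\<in>J. min (D i) (D j))"
  proof (intro sum.cong[OF refl] sum.mono_neutral_right ballI)
    fix i j assume "i \<in> J" "j \<in> N - J"
    then show "min (D i) (D j) = 0" using zero[of j] by (auto simp: J_def)
  qed (use JN in auto)
  finally have 1: "(\<Sum>i\<in>N. \<Sum>j\<in>N. min (q i) (q j)) / m \<le> (\<Sum>i\<in>J. \<Sum>j\<in>J. min (D i) (D j)) / m"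
    by (intro divide_right_mono) auto
  have "sum q N \<le> sum D N" using qD by (intro sum_mono)
  also have "\<dots> = sum D J" using JN zero by (intro sum.mono_neutral_right) auto
  finally have 2: "sum q N \<le> sum D J" .
  have 3: "sum (completion_time I S) J \<le> cost I S"
    unfolding cost_def N_def[symmetric]
  proof (rule sum_mono2)
    fix j assume "j \<in> N - J"
    then show "0 \<le> completion_time I S j" using qD(2,3)[of j] by simp
  qed (use JN in auto)
  have "(\<Sum>i\<in>J. \<Sum>j\<in>J. min (D i) (D j)) / m + sum D J \<le> 2 * sum (completion_time I S) J"
  proof (rule completion_sum_bound)
    fix J' assume "J' \<subseteq> J"
    then have "J' \<subseteq> {..<num_jobs I}" using JN by (auto simp: N_def)
    then show "(sum D J')\<^sup>2 / m + (\<Sum>j\<in>J'. (D j)\<^sup>2) \<le> 2 * (\<Sum>j\<in>J'. D j * completion_time I S j)"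
      using weighted_completion_bound[OF I S _ m] by (auto simp: D_def)
  qed (use m in \<open>auto simp: J_def\<close>)
  with 1 2 3 show "(\<Sum>i\<in>N. \<Sum>j\<in>N. min (q i) (q j)) / m + sum q N \<le> 2 * cost I S" by linarith
qed

subsection \<open>Priority list scheduling with testing\<close>

fun weight :: "real \<Rightarrow> problem \<Rightarrow> task \<Rightarrow> real" where
  "weight \<beta> I (Test j) = \<beta> * test_time I j"
| "weight \<beta> I (Exec_Tested j) = max (\<beta> * test_time I j) (test_time I j + proc_time I j)"
| "weight \<beta> I (Exec_Untested j) = upper_limit I j"

text \<open>A total preorder. For tasks of different jobs exactly one direction holds; two tasks of
  the same job with equal weight precede each other.\<close>

definition precedes :: "real \<Rightarrow> problem \<Rightarrow> task \<Rightarrow> task \<Rightarrow> bool" where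
  "precedes \<beta> I k k' \<longleftrightarrow> weight \<beta> I k < weight \<beta> I k' \<or>
     weight \<beta> I k = weight \<beta> I k' \<and> job_of k \<le> job_of k'"

definition to_test :: "real \<Rightarrow> problem \<Rightarrow> nat \<Rightarrow> bool" where
  "to_test \<alpha> I j \<longleftrightarrow> \<alpha> * test_time I j < upper_limit I j"

text \<open>Availability at time \<open>\<tau>\<close> as far as the job itself is concerned;
  machines, and whether \<open>k\<close> has been started already, are left to \<open>ready\<close>
  and \<open>waiting\<close>. The time is a parameter so that the invariant can speak about the
  past.\<close>

definition released :: "real \<Rightarrow> problem \<Rightarrow> schedule \<Rightarrow> task \<Rightarrow> real \<Rightarrow> bool" where
  "released \<alpha> I S k \<tau> \<longleftrightarrow> job_of k < num_jobs I \<and> 0 \<le> \<tau> \<and>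
     (case k of
        Test j \<Rightarrow> to_test \<alpha> I j
      | Exec_Tested j \<Rightarrow> (\<exists>b i. S (Test j) = Some (b, i) \<and> b + test_time I j \<le> \<tau>)
      | Exec_Untested j \<Rightarrow> \<not> to_test \<alpha> I j)"

definition ready :: "real \<Rightarrow> problem \<Rightarrow> schedule \<Rightarrow> real \<Rightarrow> task \<Rightarrow> bool" where
  "ready \<alpha> I S now k \<longleftrightarrow> S k = None \<and> released \<alpha> I S k now"

definition idle :: "problem \<Rightarrow> schedule \<Rightarrow> real \<Rightarrow> nat \<Rightarrow> bool" where
  "idle I S now i \<longleftrightarrow> (\<forall>k s. S k = Some (s, i) \<longrightarrow> s + duration I k \<le> now)"

definition finish_times :: "problem \<Rightarrow> schedule \<Rightarrow> real \<Rightarrow> real set" where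
  "finish_times I S now =
     {s + duration I k | k s i. S k = Some (s, i) \<and> now < s + duration I k}"

definition greedy :: "real \<Rightarrow> real \<Rightarrow> nat \<Rightarrow> problem \<Rightarrow> schedule \<Rightarrow> real \<Rightarrow> decision" where
  "greedy \<alpha> \<beta> m I S now =
     (if (\<exists>k. ready \<alpha> I S now k) \<and> (\<exists>i<m. idle I S now i)
      then Start (SOME k. ready \<alpha> I S now k \<and> (\<forall>k'. ready \<alpha> I S now k' \<longrightarrow> precedes \<beta> I k k'))
        (SOME i. i < m \<and> idle I S now i)
      else Wait (Min (finish_times I S now)))"

text \<open>
  The processing times that are not yet revealed are arbitrary here; \<open>greedy\<close> does not depend on
  them in the states that the algorithm reaches.
\<close>

definition known_problem :: "public_data \<Rightarrow> (nat \<Rightarrow> real option) \<Rightarrow> problem" where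
  "known_problem D shown = \<lparr>num_jobs = num_jobs D, test_time = test_time D,
     upper_limit = upper_limit D, proc_time = (\<lambda>j. the (shown j))\<rparr>"

definition sort_algorithm :: "real \<Rightarrow> real \<Rightarrow> nat \<Rightarrow> algorithm" where
  "sort_algorithm \<alpha> \<beta> m = (\<lambda>D S now shown. greedy \<alpha> \<beta> m (known_problem D shown) S now)"

text \<open>Half-open intervals: a machine is free again at the moment its task ends, and a task of
  length zero never occupies it.\<close>

definition busy :: "problem \<Rightarrow> schedule \<Rightarrow> nat \<Rightarrow> real \<Rightarrow> bool" where
  "busy I S i \<tau> \<longleftrightarrow> (\<exists>k s. S k = Some (s, i) \<and> s \<le> \<tau> \<and> \<tau> < s + duration I k)"

definition waiting :: "real \<Rightarrow> problem \<Rightarrow> schedule \<Rightarrow> task \<Rightarrow> real \<Rightarrow> bool" where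
  "waiting \<alpha> I S k \<tau> \<longleftrightarrow> released \<alpha> I S k \<tau> \<and> (\<forall>s i. S k = Some (s, i) \<longrightarrow> \<tau> < s)"

text \<open>The invariant of the run. The last two clauses carry the analysis: before
  \<open>now\<close> no machine is free while a task waits, and a task that starts precedes every
  task still waiting at that moment. The fourth clause stops short of \<open>now\<close> because
  more tasks may yet be started at this time.\<close>

definition greedy_state :: "real \<Rightarrow> real \<Rightarrow> nat \<Rightarrow> problem \<Rightarrow> schedule \<Rightarrow> real \<Rightarrow> bool" where
  "greedy_state \<alpha> \<beta> m I S now \<longleftrightarrow> 0 \<le> now \<and>
     (\<forall>k s i. S k = Some (s, i) \<longrightarrow> released \<alpha> I S k s \<and> s \<le> now \<and> i < m) \<and>
     (\<forall>k k' s s' i. k \<noteq> k' \<and> S k = Some (s, i) \<and> S k' = Some (s', i) \<longrightarrow>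
        s + duration I k \<le> s' \<or> s' + duration I k' \<le> s) \<and>
     (\<forall>k \<tau> i. waiting \<alpha> I S k \<tau> \<and> \<tau> < now \<and> i < m \<longrightarrow> busy I S i \<tau>) \<and>
     (\<forall>k k' s i. waiting \<alpha> I S k s \<and> S k' = Some (s, i) \<longrightarrow> precedes \<beta> I k' k)"

definition all_tasks :: "real \<Rightarrow> problem \<Rightarrow> task set" where
  "all_tasks \<alpha> I = {k. job_of k < num_jobs I \<and>
     (case k of Exec_Untested j \<Rightarrow> \<not> to_test \<alpha> I j | _ \<Rightarrow> to_test \<alpha> I (job_of k))}"

text \<open>A termination measure: a start trades two units for at most one, and waiting until the
  next finish removes at least one running task.\<close>

definition remaining :: "real \<Rightarrow> problem \<Rightarrow> schedule \<Rightarrow> real \<Rightarrow> nat" where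
  "remaining \<alpha> I S now = 2 * card (all_tasks \<alpha> I - dom S) +
     card {k \<in> dom S. now < start S k + duration I k}"

section \<open>The order on tasks and the effect of a new task\<close>

lemma precedes_refl [simp]: "precedes \<beta> I k k"
  by (simp add: precedes_def)

lemma precedes_trans: "precedes \<beta> I k k' \<Longrightarrow> precedes \<beta> I k' k'' \<Longrightarrow> precedes \<beta> I k k''"
  by (auto simp: precedes_def)

lemma precedes_total: "\<not> precedes \<beta> I k k' \<Longrightarrow> precedes \<beta> I k' k"
  by (auto simp: precedes_def)

text \<open>This is the purpose of the \<open>max\<close> in the weight of a tested execution:
  whatever precedes a test also precedes the execution of that job.\<close>

lemma precedes_Test_Exec: "precedes \<beta> I (Test j) (Exec_Tested j)"
  by (auto simp: precedes_def)

lemma finite_all_tasks: "finite (all_tasks \<alpha> I)"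
  by (rule finite_subset[OF _ finite_tasks[of "num_jobs I"]]) (auto simp: all_tasks_def)

lemma ex_first_task:
  assumes "finite X" "X \<noteq> {}"
  shows "\<exists>k\<in>X. \<forall>k'\<in>X. precedes \<beta> I k k'"
  using assms
proof (induction X rule: finite_ne_induct)
  case (insert x X)
  then obtain k where "k \<in> X" "\<forall>k'\<in>X. precedes \<beta> I k k'" by blast
  then show ?case
    by (cases "precedes \<beta> I k x") (auto dest: precedes_total intro: precedes_trans)
qed auto

lemma ready_first:
  assumes "ready \<alpha> I S now k0"
  shows "\<exists>k. ready \<alpha> I S now k \<and> (\<forall>k'. ready \<alpha> I S now k' \<longrightarrow> precedes \<beta> I k k')"
proof -
  have "finite {k. ready \<alpha> I S now k}"
    by (rule finite_subset[OF _ finite_tasks[of "num_jobs I"]]) (auto simp: ready_def released_def)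
  then show ?thesis using ex_first_task[of "{k. ready \<alpha> I S now k}"] assms by auto
qed

lemma released_upd:
  assumes "released \<alpha> I (S(k0 \<mapsto> (b, i))) k \<tau>"
  shows "released \<alpha> I S k \<tau> \<or>
    (\<exists>j. k = Exec_Tested j \<and> k0 = Test j \<and> b + test_time I j \<le> \<tau> \<and> 0 \<le> \<tau>)"
  using assms by (auto simp: released_def split: task.splits if_splits)

lemma released_upd_mono:
  assumes "released \<alpha> I S k \<tau>" "S k0 = None"
  shows "released \<alpha> I (S(k0 \<mapsto> p)) k \<tau>"
  using assms by (auto simp: released_def split: task.splits if_splits)

lemma busy_upd_mono:
  assumes "busy I S i \<tau>" "S k0 = None" shows "busy I (S(k0 \<mapsto> p)) i \<tau>"
  using assms unfolding busy_def by (metis fun_upd_apply option.distinct(1))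

section \<open>Preservation of the invariant and progress\<close>

context
  fixes \<alpha> \<beta> :: real and m :: nat and I :: problem and S :: schedule and now :: real
  assumes valid: "valid_problem I" and state: "greedy_state \<alpha> \<beta> m I S now"
begin

lemma started:
  assumes "S k = Some (s, i)" shows "released \<alpha> I S k s" "s \<le> now" "i < m" "0 \<le> s"
  using assms state by (auto simp: greedy_state_def released_def)

lemma not_overlapping:
  assumes "k \<noteq> k'" "S k = Some (s, i)" "S k' = Some (s', i)"
  shows "s + duration I k \<le> s' \<or> s' + duration I k' \<le> s"
  using assms state unfolding greedy_state_def by blast

lemma waiting_busy:
  assumes "waiting \<alpha> I S k \<tau>" "\<tau> < now" "i < m" shows "busy I S i \<tau>"
  using assms state unfolding greedy_state_def by blast

lemma waiting_precedes:
  assumes "waiting \<alpha> I S k s" "S k' = Some (s, i)" shows "precedes \<beta> I k' k"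
  using assms state unfolding greedy_state_def by blast

lemma dom_subset: "dom S \<subseteq> all_tasks \<alpha> I"
proof
  fix k assume "k \<in> dom S"
  then obtain s i where k: "S k = Some (s, i)" by auto
  show "k \<in> all_tasks \<alpha> I"
    using started(1)[OF k] started(1)[of "Test (job_of k)"]
    by (cases k) (auto simp: released_def all_tasks_def)
qed

lemma finite_finish_times: "finite (finish_times I S now)"
proof -
  have "finish_times I S now \<subseteq> (\<lambda>k. start S k + duration I k) ` dom S"
    by (force simp: finish_times_def start_def)
  then show ?thesis using dom_subset finite_all_tasks by (meson finite_imageI finite_subset)
qed

text \<open>The policy is online: \<open>greedy\<close> only consults processing times of executions
  that are ready or have been started, and by the invariant their tests have ended, so these times
  are revealed.\<close>

lemma greedy_known:
  "greedy \<alpha> \<beta> m (known_problem (public_data.truncate I) (revealed I S now)) S now =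
   greedy \<alpha> \<beta> m I S now"
proof -
  define I' where "I' = known_problem (public_data.truncate I) (revealed I S now)"
  have [simp]: "num_jobs I' = num_jobs I" "test_time I' = test_time I" "upper_limit I' = upper_limit I"
    by (simp_all add: I'_def known_problem_def public_data.defs)
  have rel: "released \<alpha> I' = released \<alpha> I" "ready \<alpha> I' = ready \<alpha> I"
    by (simp_all add: released_def ready_def to_test_def fun_eq_iff split: task.split)
  have p: "proc_time I' j = proc_time I j" if "released \<alpha> I S (Exec_Tested j) now" for j
  proof -
    have "\<exists>s i. S (Test j) = Some (s, i) \<and> s + test_time I j \<le> now"
      using that by (auto simp: released_def)
    then show ?thesis by (simp add: I'_def known_problem_def revealed_def)
  qed
  have dur: "duration I' k = duration I k" if k: "S k = Some (s, i)" for k s i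
  proof (cases k)
    case (Exec_Tested j)
    have "released \<alpha> I S (Exec_Tested j) now"
      using started[OF k] Exec_Tested by (force simp: released_def)
    then show ?thesis using Exec_Tested p by simp
  qed auto
  have wt: "weight \<beta> I' k = weight \<beta> I k" if "ready \<alpha> I S now k" for k
    using that p by (cases k) (auto simp: ready_def)
  have "idle I' S now = idle I S now" using dur by (auto simp: idle_def fun_eq_iff)
  moreover have "finish_times I' S now = finish_times I S now"
    using dur by (fastforce simp: finish_times_def)
  moreover have "(\<lambda>k. ready \<alpha> I S now k \<and> (\<forall>k'. ready \<alpha> I S now k' \<longrightarrow> precedes \<beta> I' k k')) =
      (\<lambda>k. ready \<alpha> I S now k \<and> (\<forall>k'. ready \<alpha> I S now k' \<longrightarrow> precedes \<beta> I k k'))"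
    using wt by (auto simp: precedes_def fun_eq_iff)
  ultimately show ?thesis unfolding I'_def[symmetric] by (simp add: greedy_def rel)
qed

lemma start_state:
  assumes k0: "ready \<alpha> I S now k0" and min: "\<And>k. ready \<alpha> I S now k \<Longrightarrow> precedes \<beta> I k0 k"
    and i0: "i0 < m" "idle I S now i0"
  shows "greedy_state \<alpha> \<beta> m I (S(k0 \<mapsto> (now, i0))) now"
proof -
  let ?S = "S(k0 \<mapsto> (now, i0))"
  have new: "S k0 = None" "released \<alpha> I S k0 now" using k0 by (auto simp: ready_def)
  show ?thesis
    unfolding greedy_state_def
  proof (intro conjI allI impI; (elim conjE)?)
    show "0 \<le> now" using state by (simp add: greedy_state_def)
  next
    fix k s i assume k: "?S k = Some (s, i)"
    show "released \<alpha> I ?S k s"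
      using k new(2) started(1)[of k s i]
      by (intro released_upd_mono new(1)) (auto split: if_splits)
    show "s \<le> now" "i < m" using k i0 started(2,3) by (auto split: if_splits)
  next
    fix k k' s s' i assume "k \<noteq> k'" "?S k = Some (s, i)" "?S k' = Some (s', i)"
    then show "s + duration I k \<le> s' \<or> s' + duration I k' \<le> s"
      using i0(2) not_overlapping[of k k' s i s'] by (auto simp: idle_def split: if_splits)
  next
    fix k \<tau> i assume k: "waiting \<alpha> I ?S k \<tau>" and \<tau>: "\<tau> < now" "i < m"
    \<comment> \<open>A test started at \<open>now\<close> ends no earlier than \<open>now\<close>,
      so it releases nothing at the earlier time \<open>\<tau>\<close>.\<close>
    have "released \<alpha> I S k \<tau>"
    proof -
      have "\<not> now + test_time I j \<le> \<tau>" if "k0 = Test j" for j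
        using valid \<tau>(1) new(2) that by (auto simp: valid_problem_def released_def)
      then show ?thesis using k released_upd[of \<alpha> I S k0 now i0 k \<tau>] by (auto simp: waiting_def)
    qed
    then have "waiting \<alpha> I S k \<tau>" using k new(1) by (auto simp: waiting_def split: if_splits)
    then show "busy I ?S i \<tau>" using waiting_busy \<tau> new(1) by (intro busy_upd_mono)
  next
    fix k k' s i assume k: "waiting \<alpha> I ?S k s" and k': "?S k' = Some (s, i)"
    have s: "s \<le> now" using k' started(2) by (auto split: if_splits)
    from k released_upd consider (old) "released \<alpha> I S k s"
      | (new) j where "k = Exec_Tested j" "k0 = Test j" "now + test_time I j \<le> s"
      unfolding waiting_def by blast
    then show "precedes \<beta> I k' k"
    proof cases
      case old
      show ?thesis
      proof (cases "k' = k0")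
        case True
        with k' have "s = now" by simp
        with k have "k \<noteq> k0" by (auto simp: waiting_def)
        with k \<open>s = now\<close> have "\<not> t \<le> now" if "S k = Some (t, i)" for t i
          using that by (auto simp: waiting_def)
        then have "S k = None" using started(2) by (cases "S k") auto
        with \<open>k \<noteq> k0\<close> old \<open>s = now\<close> True min show ?thesis by (simp add: ready_def)
      next
        case False
        have "waiting \<alpha> I S k s" using old k new(1) by (auto simp: waiting_def split: if_splits)
        with False k' show ?thesis by (auto intro: waiting_precedes)
      qed
    next
      \<comment> \<open>This happens only for a test of length zero, whose execution is released at
        once. The task \<open>k'\<close> is then compared with the test, which either is
        \<open>k'\<close> or was still waiting when \<open>k'\<close> started.\<close>
      case (new j)
      then have "0 \<le> test_time I j"
        using valid \<open>released \<alpha> I S k0 now\<close> by (auto simp: valid_problem_def released_def)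
      with new s have "s = now" by simp
      have "precedes \<beta> I k' (Test j)"
      proof (cases "k' = k0")
        case False
        have "waiting \<alpha> I S (Test j) s"
          using new \<open>s = now\<close> \<open>S k0 = None\<close> \<open>released \<alpha> I S k0 now\<close> by (auto simp: waiting_def)
        with False k' show ?thesis by (auto intro: waiting_precedes)
      qed (simp add: new)
      then show ?thesis using precedes_Test_Exec new(1) precedes_trans by blast
    qed
  qed
qed

text \<open>No task ends strictly between \<open>now\<close> and \<open>w\<close>. So in this period
  no execution is released and no machine becomes free, and what blocked the policy at
  \<open>now\<close> persists.\<close>

lemma wait_state:
  assumes blocked: "\<not> ((\<exists>k. ready \<alpha> I S now k) \<and> (\<exists>i<m. idle I S now i))"
    and w: "now \<le> w" "\<And>t. t \<in> finish_times I S now \<Longrightarrow> w \<le> t"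
  shows "greedy_state \<alpha> \<beta> m I S w"
  unfolding greedy_state_def
proof (intro conjI allI impI; (elim conjE)?)
  show "0 \<le> w" using state w(1) by (simp add: greedy_state_def)
next
  fix k s i assume "S k = Some (s, i)"
  then show "released \<alpha> I S k s" "s \<le> w" "i < m" using started[of k s i] w(1) by auto
next
  fix k k' s s' i assume "k \<noteq> k'" "S k = Some (s, i)" "S k' = Some (s', i)"
  then show "s + duration I k \<le> s' \<or> s' + duration I k' \<le> s" by (rule not_overlapping)
next
  fix k \<tau> i assume k: "waiting \<alpha> I S k \<tau>" and \<tau>: "\<tau> < w" and i: "i < m"
  show "busy I S i \<tau>"
  proof (cases "\<tau> < now")
    case False
    \<comment> \<open>A task released at \<open>\<tau>\<close> but not at \<open>now\<close> would
      be an execution whose test ends after \<open>now\<close> and before \<open>w\<close>.\<close>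
    have "released \<alpha> I S k now"
    proof (rule ccontr)
      assume not: "\<not> released \<alpha> I S k now"
      then obtain j b i' where j: "k = Exec_Tested j" "S (Test j) = Some (b, i')"
        "b + test_time I j \<le> \<tau>"
        using k state by (auto simp: waiting_def released_def greedy_state_def split: task.splits)
      moreover have "now < b + test_time I j"
        using not j k state by (force simp: waiting_def released_def greedy_state_def)
      ultimately have "b + test_time I j \<in> finish_times I S now"
        by (force simp: finish_times_def)
      then show False using w(2) j(3) \<tau> by force
    qed
    moreover have "S k = None"
      using k False started(2)[of k] by (cases "S k") (fastforce simp: waiting_def)+
    ultimately have "ready \<alpha> I S now k" by (simp add: ready_def)
    then have "\<not> idle I S now i" using blocked i by blast
    then obtain k' s where k': "S k' = Some (s, i)" "now < s + duration I k'"
      by (auto simp: idle_def not_le)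
    then have "w \<le> s + duration I k'" by (intro w(2)) (auto simp: finish_times_def)
    then show ?thesis using k' started(2)[OF k'(1)] False \<tau>
      unfolding busy_def by (intro exI[of _ k'] exI[of _ s]) auto
  qed (use k i waiting_busy in blast)
next
  fix k k' s i assume "waiting \<alpha> I S k s" "S k' = Some (s, i)"
  then show "precedes \<beta> I k' k" by (rule waiting_precedes)
qed

text \<open>This makes the \<open>Min\<close> in \<open>greedy\<close> well defined. Either no
  machine is idle, and some task is running on machine 0, or nothing is ready; a missing task is
  then an execution whose test is still running.\<close>

lemma unfinished_cases:
  assumes "dom S \<noteq> all_tasks \<alpha> I" and "m \<ge> 1"
    and "\<not> ((\<exists>k. ready \<alpha> I S now k) \<and> (\<exists>i<m. idle I S now i))"
  shows "finish_times I S now \<noteq> {}"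
proof (cases "\<exists>i<m. idle I S now i")
  case False
  then have "\<not> idle I S now 0" using assms(2) by auto
  then show ?thesis by (fastforce simp: idle_def finish_times_def not_le)
next
  case True
  with assms(3) have none: "\<not> ready \<alpha> I S now k" for k by blast
  obtain k where k: "k \<in> all_tasks \<alpha> I" "S k = None" using assms(1) dom_subset by blast
  have now: "0 \<le> now" using state by (simp add: greedy_state_def)
  from k none[of k] now obtain j where j: "k = Exec_Tested j" "to_test \<alpha> I j" "j < num_jobs I"
    by (cases k) (auto simp: ready_def released_def all_tasks_def)
  from none[of "Test j"] j now obtain b i where b: "S (Test j) = Some (b, i)"
    by (auto simp: ready_def released_def)
  with none[of k] j k now have "now < b + test_time I j"
    by (force simp: ready_def released_def)
  with b show ?thesis by (force simp: finish_times_def)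
qed

lemma step_progress:
  assumes m: "m \<ge> 1" and unfinished: "dom S \<noteq> all_tasks \<alpha> I"
  obtains S' now' where "step (sort_algorithm \<alpha> \<beta> m) I (S, now) = (S', now')"
    "greedy_state \<alpha> \<beta> m I S' now'" "remaining \<alpha> I S' now' < remaining \<alpha> I S now"
proof (cases "(\<exists>k. ready \<alpha> I S now k) \<and> (\<exists>i<m. idle I S now i)")
  case True
  define k0 where
    "k0 = (SOME k. ready \<alpha> I S now k \<and> (\<forall>k'. ready \<alpha> I S now k' \<longrightarrow> precedes \<beta> I k k'))"
  define i0 where "i0 = (SOME i. i < m \<and> idle I S now i)"
  have k0: "ready \<alpha> I S now k0" "ready \<alpha> I S now k \<Longrightarrow> precedes \<beta> I k0 k" for k
    using someI_ex[OF ready_first] True unfolding k0_def by blast+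
  have i0: "i0 < m" "idle I S now i0" using someI_ex[OF conjunct2[OF True]] unfolding i0_def by blast+
  have greedy: "greedy \<alpha> \<beta> m I S now = Start k0 i0"
    unfolding greedy_def k0_def i0_def using True by (rule if_P)
  let ?S = "S(k0 \<mapsto> (now, i0))"
  have state': "greedy_state \<alpha> \<beta> m I ?S now" using k0 i0 by (rule start_state)
  have none: "S k0 = None" using k0 by (simp add: ready_def)
  have fin: "finite (dom S)" using dom_subset finite_all_tasks finite_subset by blast
  have k0_task: "k0 \<in> all_tasks \<alpha> I"
    using k0(1) started(1)[of "Test (job_of k0)"]
    by (cases k0) (auto simp: ready_def released_def all_tasks_def)
  have "all_tasks \<alpha> I - dom S = insert k0 (all_tasks \<alpha> I - dom ?S)" using k0_task none by auto
  moreover have "k0 \<notin> all_tasks \<alpha> I - dom ?S" by simp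
  ultimately have "card (all_tasks \<alpha> I - dom S) = Suc (card (all_tasks \<alpha> I - dom ?S))"
    using finite_all_tasks by (metis card_insert_disjoint finite_Diff)
  moreover have "card {k \<in> dom ?S. now < start ?S k + duration I k} \<le>
      card (insert k0 {k \<in> dom S. now < start S k + duration I k})"
    using fin by (intro card_mono) (auto simp: start_def)
  moreover have "\<dots> \<le> Suc (card {k \<in> dom S. now < start S k + duration I k})"
    by (rule card_insert_le_m1) auto
  ultimately have "remaining \<alpha> I ?S now < remaining \<alpha> I S now" by (simp add: remaining_def)
  moreover have "step (sort_algorithm \<alpha> \<beta> m) I (S, now) = (?S, now)"
    using none by (simp add: step_def sort_algorithm_def greedy_known greedy)
  ultimately show ?thesis using that state' by blast
next
  case False
  define w where "w = Min (finish_times I S now)"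
  have ne: "finish_times I S now \<noteq> {}" using unfinished_cases[OF unfinished m False] .
  have w: "w \<in> finish_times I S now" "\<And>t. t \<in> finish_times I S now \<Longrightarrow> w \<le> t"
    unfolding w_def using Min_in[OF finite_finish_times ne] finite_finish_times by auto
  then have now: "now < w" by (auto simp: finish_times_def)
  \<comment> \<open>Ends of tests are finish times, so the policy is not woken up before
    \<open>w\<close>.\<close>
  have sub: "pending_tests I S now \<subseteq> finish_times I S now"
    by (force simp: pending_tests_def finish_times_def)
  have greedy: "greedy \<alpha> \<beta> m I S now = Wait w"
    unfolding greedy_def w_def using False by (rule if_not_P)
  have "Min (insert (max now w) (pending_tests I S now)) = w"
    using sub now w(2) finite_finish_times finite_subset by (intro Min_eqI) auto
  then have "step (sort_algorithm \<alpha> \<beta> m) I (S, now) = (S, w)"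
    by (simp add: step_def sort_algorithm_def greedy_known greedy)
  moreover have "greedy_state \<alpha> \<beta> m I S w" using False now w(2) by (intro wait_state) auto
  moreover have "remaining \<alpha> I S w < remaining \<alpha> I S now"
  proof -
    obtain k s i where k: "S k = Some (s, i)" "w = s + duration I k"
      using w(1) by (auto simp: finish_times_def)
    have "finite (dom S)" using dom_subset finite_all_tasks finite_subset by blast
    moreover have "{k \<in> dom S. w < start S k + duration I k} \<subset>
        {k \<in> dom S. now < start S k + duration I k}"
    proof (rule psubsetI)
      have "k \<in> {k \<in> dom S. now < start S k + duration I k}"
        "k \<notin> {k \<in> dom S. w < start S k + duration I k}"
        using k now by (auto simp: start_def)
      then show "{k \<in> dom S. w < start S k + duration I k} \<noteq>
        {k \<in> dom S. now < start S k + duration I k}" by blast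
    qed (use now in auto)
    ultimately have "card {k \<in> dom S. w < start S k + duration I k} <
        card {k \<in> dom S. now < start S k + duration I k}"
      by (intro psubset_card_mono) auto
    then show ?thesis by (simp add: remaining_def)
  qed
  ultimately show ?thesis using that by blast
qed

end

section \<open>Termination and feasibility of the final schedule\<close>

lemma run_completes:
  assumes I: "valid_problem I" and m: "m \<ge> 1"
  obtains N S now where "run (sort_algorithm \<alpha> \<beta> m) I N = (S, now)"
    "greedy_state \<alpha> \<beta> m I S now" "dom S = all_tasks \<alpha> I"
proof -
  have "\<exists>N S now. run (sort_algorithm \<alpha> \<beta> m) I N = (S, now) \<and> greedy_state \<alpha> \<beta> m I S now \<and>
      dom S = all_tasks \<alpha> I"
    if "run (sort_algorithm \<alpha> \<beta> m) I N = (S, now)" "greedy_state \<alpha> \<beta> m I S now" for N S now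
    using that
  proof (induction "remaining \<alpha> I S now" arbitrary: N S now rule: less_induct)
    case less
    show ?case
    proof (cases "dom S = all_tasks \<alpha> I")
      case False
      from step_progress[OF I less.prems(2) m False] obtain S' now' where
        "step (sort_algorithm \<alpha> \<beta> m) I (S, now) = (S', now')" "greedy_state \<alpha> \<beta> m I S' now'"
        "remaining \<alpha> I S' now' < remaining \<alpha> I S now" .
      moreover from this(1) less.prems(1) have
        "run (sort_algorithm \<alpha> \<beta> m) I (Suc N) = (S', now')" by (simp add: run_def)
      ultimately show ?thesis by (intro less.hyps)
    qed (use less.prems in blast)
  qed
  moreover have "run (sort_algorithm \<alpha> \<beta> m) I 0 = (Map.empty, 0)" by (simp add: run_def)
  moreover have "greedy_state \<alpha> \<beta> m I Map.empty 0"
    by (auto simp: greedy_state_def waiting_def released_def)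
  ultimately show ?thesis using that by blast
qed

lemma complete_feasible:
  assumes I: "valid_problem I" and S: "greedy_state \<alpha> \<beta> m I S now" and d: "dom S = all_tasks \<alpha> I"
  shows "feasible m I S"
  unfolding feasible_def
proof (intro conjI allI impI; (elim conjE)?)
  fix k s i assume "S k = Some (s, i)"
  from started[OF I S this] show "job_of k < num_jobs I" "0 \<le> s" "i < m"
    by (auto simp: released_def)
next
  fix k k' s s' i assume "k \<noteq> k'" "S k = Some (s, i)" "S k' = Some (s', i)"
  then show "s + duration I k \<le> s' \<or> s' + duration I k' \<le> s" by (rule not_overlapping[OF I S])
next
  fix j assume j: "j < num_jobs I"
  have *: "S k \<noteq> None \<longleftrightarrow> k \<in> all_tasks \<alpha> I" for k unfolding d[symmetric] by auto
  show "runs_untested S j \<or> runs_tested I S j"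
  proof (cases "to_test \<alpha> I j")
    case False
    then show ?thesis using *[of "Test j"] *[of "Exec_Tested j"] *[of "Exec_Untested j"] j
      by (simp add: runs_untested_def all_tasks_def del: not_None_eq)
  next
    case True
    then obtain s i where x: "S (Exec_Tested j) = Some (s, i)"
      using *[of "Exec_Tested j"] j by (auto simp: all_tasks_def)
    from started(1)[OF I S this] True *[of "Exec_Untested j"] x show ?thesis
      by (auto simp: runs_tested_def all_tasks_def released_def)
  qed
qed

subsection \<open>Delays between jobs\<close>

definition final_task :: "real \<Rightarrow> problem \<Rightarrow> nat \<Rightarrow> task" where
  "final_task \<alpha> I j = (if to_test \<alpha> I j then Exec_Tested j else Exec_Untested j)"

text \<open>The part of the work on \<open>h\<close> that can keep machines busy while
  \<open>j\<close> waits. It depends on the order of the tasks but not on their starting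
  times.\<close>

definition delay :: "real \<Rightarrow> real \<Rightarrow> problem \<Rightarrow> schedule \<Rightarrow> nat \<Rightarrow> nat \<Rightarrow> real" where
  "delay \<alpha> \<beta> I S h j =
     sum (duration I) {k \<in> job_tasks S h. precedes \<beta> I k (final_task \<alpha> I j)}"

lemma job_of_final_task [simp]: "job_of (final_task \<alpha> I j) = j"
  by (simp add: final_task_def)

text \<open>Subadditivity of Lebesgue measure. The two intervals are the waiting phases of a tested
  job: until its test starts at \<open>b\<close>, and from the end \<open>e\<close> of the test to
  the start \<open>x\<close> of the execution.\<close>

lemma covering_length:
  fixes s d :: "'a \<Rightarrow> real"
  assumes "finite K" and d: "\<And>k. k \<in> K \<Longrightarrow> 0 \<le> d k" and "0 \<le> b" "b \<le> e" "e \<le> x"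
    and cover: "\<And>\<tau>. \<tau> \<in> {0..<b} \<union> {e..<x} \<Longrightarrow> \<exists>k\<in>K. s k \<le> \<tau> \<and> \<tau> < s k + d k"
  shows "b + (x - e) \<le> sum d K"
proof -
  have len: "measure lborel {u..<v} = v - u" if "u \<le> v" for u v :: real
    using that by (simp add: measure_def)
  have "b + (x - e) = measure lborel {0..<b} + measure lborel {e..<x}"
    using assms(3-5) by (simp add: len)
  also have "\<dots> = measure lborel ({0..<b} \<union> {e..<x})"
    using assms(3-5) by (intro measure_Un_AE[symmetric]) (auto simp: fmeasurable_def)
  also have "\<dots> \<le> measure lborel (\<Union>k\<in>K. {s k..<s k + d k})"
  proof (rule measure_mono_fmeasurable)
    show "{0..<b} \<union> {e..<x} \<subseteq> (\<Union>k\<in>K. {s k..<s k + d k})"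
      using cover by fastforce
    show "(\<Union>k\<in>K. {s k..<s k + d k}) \<in> fmeasurable lborel"
      using assms(1,2) by (intro fmeasurable.finite_UN) (auto simp: fmeasurable_def)
  qed auto
  also have "\<dots> \<le> (\<Sum>k\<in>K. measure lborel {s k..<s k + d k})"
    using assms(1) by (intro measure_UNION_le) auto
  also have "\<dots> = sum d K" using d by (intro sum.cong) (auto simp: len)
  finally show ?thesis .
qed

section \<open>Completion times in terms of delays\<close>

context
  fixes \<alpha> \<beta> :: real and m :: nat and I :: problem and S :: schedule and now :: real
  assumes valid: "valid_problem I" and state: "greedy_state \<alpha> \<beta> m I S now"
    and complete: "dom S = all_tasks \<alpha> I"
begin

lemma feasible_schedule: "feasible m I S"
  using complete_feasible[OF valid state complete] .

lemma task_started:
  assumes "k \<in> all_tasks \<alpha> I"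
  shows "S k = Some (start S k, machine S k)" "start S k \<le> now" "machine S k < m" "0 \<le> start S k"
proof -
  show *: "S k = Some (start S k, machine S k)" using assms complete dom_start by blast
  show "start S k \<le> now" "machine S k < m" "0 \<le> start S k" using started[OF valid state *] by auto
qed

lemma tested_tasks:
  assumes "j < num_jobs I" "to_test \<alpha> I j"
  shows "Test j \<in> all_tasks \<alpha> I" "Exec_Tested j \<in> all_tasks \<alpha> I"
    "start S (Test j) + test_time I j \<le> start S (Exec_Tested j)"
proof -
  show *: "Test j \<in> all_tasks \<alpha> I" "Exec_Tested j \<in> all_tasks \<alpha> I"
    using assms by (auto simp: all_tasks_def)
  show "start S (Test j) + test_time I j \<le> start S (Exec_Tested j)"
    using started(1)[OF valid state task_started(1)[OF *(2)]]
    by (auto simp: released_def start_def)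
qed

lemma released_tested:
  assumes "j < num_jobs I" "to_test \<alpha> I j"
  shows "released \<alpha> I S (Test j) \<tau> \<longleftrightarrow> 0 \<le> \<tau>"
    "released \<alpha> I S (Exec_Tested j) \<tau> \<longleftrightarrow> start S (Test j) + test_time I j \<le> \<tau>"
proof -
  have T: "S (Test j) = Some (start S (Test j), machine S (Test j))" "0 \<le> start S (Test j)"
    using task_started tested_tasks(1)[OF assms] by blast+
  then show "released \<alpha> I S (Test j) \<tau> \<longleftrightarrow> 0 \<le> \<tau>"
    "released \<alpha> I S (Exec_Tested j) \<tau> \<longleftrightarrow> start S (Test j) + test_time I j \<le> \<tau>"
    using assms valid by (auto simp: released_def valid_problem_def)
qed

text \<open>
  When \<open>l\<close> starts, no task that precedes it is ready.  So all later tasks that precede \<open>l\<close> are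
  executions whose tests are running at that moment, and each of them finds the machine of its test
  free when the test finishes.
\<close>

lemma exec_immediate:
  assumes l: "S l = Some (s, il)" and j: "j < num_jobs I" "to_test \<alpha> I j"
    and not: "\<not> precedes \<beta> I l (Exec_Tested j)" and s: "s < start S (Test j) + test_time I j"
  shows "start S (Exec_Tested j) = start S (Test j) + test_time I j"
proof (rule ccontr)
  define e where "e h = start S (Test h) + test_time I h" for h
  define P where "P = {h. h < num_jobs I \<and> to_test \<alpha> I h \<and> \<not> precedes \<beta> I l (Exec_Tested h) \<and> s < e h}"
  \<comment> \<open>\<open>P\<close> collects the executions not preceded by \<open>l\<close> whose
    tests end after \<open>s\<close>, and \<open>B\<close> those that do not start right after their
    tests. A member \<open>j'\<close> of \<open>B\<close> whose test ends earliest leads to a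
    contradiction by the pigeonhole principle.\<close>
  define B where "B = {h \<in> P. start S (Exec_Tested h) \<noteq> e h}"
  assume "start S (Exec_Tested j) \<noteq> start S (Test j) + test_time I j"
  then have "j \<in> B" using j not s by (simp add: B_def P_def e_def)
  have finP: "finite P" by (simp add: P_def)
  then have finB: "finite B" by (simp add: B_def)
  obtain j' where j': "j' \<in> B" and min: "\<And>h. h \<in> B \<Longrightarrow> e j' \<le> e h"
    using arg_min_if_finite[OF finB, of e] \<open>j \<in> B\<close> by (metis empty_iff not_le)
  define J where "J = {h \<in> P. e h = e j'}"
  have P: "Test h \<in> all_tasks \<alpha> I" "Exec_Tested h \<in> all_tasks \<alpha> I" "e h \<le> start S (Exec_Tested h)"
    "start S (Test h) \<le> s" if "h \<in> P" for h
  proof -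
    have h: "h < num_jobs I" "to_test \<alpha> I h" using that by (auto simp: P_def)
    show *: "Test h \<in> all_tasks \<alpha> I" "Exec_Tested h \<in> all_tasks \<alpha> I" "e h \<le> start S (Exec_Tested h)"
      using tested_tasks[OF h] by (auto simp: e_def)
    show "start S (Test h) \<le> s"
    proof (rule ccontr)
      assume "\<not> start S (Test h) \<le> s"
      then have "waiting \<alpha> I S (Test h) s"
        using released_tested(1)[OF h] task_started(1)[OF *(1)] started(4)[OF valid state l]
        by (auto simp: waiting_def)
      then have "precedes \<beta> I l (Test h)" using waiting_precedes[OF valid state] l by blast
      then show False using that precedes_trans[OF _ precedes_Test_Exec] by (auto simp: P_def)
    qed
  qed
  have j'P: "j' \<in> P" "e j' < start S (Exec_Tested j')"
    using j' P(3)[of j'] by (auto simp: B_def)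
  have wait: "waiting \<alpha> I S (Exec_Tested j') (e j')"
    using j'P released_tested(2)[of j'] task_started(1)[OF P(2)[OF j'P(1)]]
    by (auto simp: waiting_def P_def e_def)
  \<comment> \<open>\<open>J\<close> consists of the jobs in \<open>P\<close> whose tests end
    together with that of \<open>j'\<close>. At this moment \<open>Exec_Tested j'\<close> waits, so
    the machine of \<open>Test h\<close> must be taken over at once by a task \<open>k\<close>. As
    \<open>l\<close> does not precede \<open>k\<close>, the latter was not released at
    \<open>s\<close>; it is thus the execution of a job in \<open>P\<close>, and minimality of
    \<open>e j'\<close> puts this job into \<open>J\<close>.\<close>
  have "\<exists>h'\<in>J - {j'}. machine S (Exec_Tested h') = machine S (Test h)" if h: "h \<in> J" for h
  proof -
    have hP: "h \<in> P" "e h = e j'" using h by (auto simp: J_def)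
    have Th: "S (Test h) = Some (start S (Test h), machine S (Test h))" "machine S (Test h) < m"
      using task_started P(1)[OF hP(1)] by auto
    have "e j' < now" using j'P task_started(2)[OF P(2)[OF j'P(1)]] by simp
    with waiting_busy[OF valid state wait _ Th(2)] obtain k t where
      k: "S k = Some (t, machine S (Test h))" "t \<le> e j'" "e j' < t + duration I k"
      by (auto simp: busy_def)
    have "s < e j'" using j'P by (simp add: P_def)
    have "k \<noteq> Test h" using k Th(1) hP(2) by (auto simp: e_def)
    from not_overlapping[OF valid state this k(1) Th(1)] have t: "t = e j'"
      using k hP P(4)[OF hP(1)] \<open>s < e j'\<close> by (auto simp: e_def)
    then have "precedes \<beta> I k (Exec_Tested j')" using waiting_precedes[OF valid state wait] k(1) by blast
    then have lk: "\<not> precedes \<beta> I l k" using precedes_trans j'P(1) by (auto simp: P_def)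
    have "\<not> waiting \<alpha> I S k s" using waiting_precedes[OF valid state] l lk by blast
    then have nrel: "\<not> released \<alpha> I S k s" using k(1) t \<open>s < e j'\<close> by (auto simp: waiting_def)
    have k_task: "k \<in> all_tasks \<alpha> I" using k(1) complete by auto
    have "\<exists>h'. k = Exec_Tested h'"
      using nrel k_task started(4)[OF valid state l]
      by (cases k) (auto simp: released_def all_tasks_def)
    then obtain h' where h': "k = Exec_Tested h'" by blast
    with k_task have h'2: "h' < num_jobs I" "to_test \<alpha> I h'" by (auto simp: all_tasks_def)
    have x: "start S (Exec_Tested h') = e j'" "machine S (Exec_Tested h') = machine S (Test h)"
      using k(1) h' t by (auto simp: start_def machine_def)
    have "s < e h'" using nrel released_tested(2)[OF h'2] h' by (simp add: e_def)
    then have h'P: "h' \<in> P" using h' h'2 lk by (simp add: P_def)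
    have "e h' = e j'"
    proof (rule ccontr)
      assume "e h' \<noteq> e j'"
      then have "e h' < e j'" "h' \<in> B" using P(3)[OF h'P] h'P x by (auto simp: B_def)
      then show False using min by force
    qed
    then have "h' \<in> J - {j'}" using h'P x j'P by (auto simp: J_def)
    with x show ?thesis by blast
  qed
  then obtain f where f: "\<And>h. h \<in> J \<Longrightarrow> f h \<in> J - {j'} \<and>
      machine S (Exec_Tested (f h)) = machine S (Test h)"
    by metis
  \<comment> \<open>All tests of jobs in \<open>J\<close> are running just after \<open>s\<close>,
    hence on different machines. So \<open>J\<close> would inject into
    \<open>J - {j'}\<close>.\<close>
  have "inj_on f J"
  proof (rule inj_onI, rule ccontr)
    fix h h' assume h: "h \<in> J" "h' \<in> J" "f h = f h'" "h \<noteq> h'"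
    then have M: "machine S (Test h) = machine S (Test h')" using f by metis
    have hP: "h \<in> P" "h' \<in> P" using h by (auto simp: J_def)
    have "S (Test h) = Some (start S (Test h), machine S (Test h'))"
      "S (Test h') = Some (start S (Test h'), machine S (Test h'))"
      using task_started(1) P(1) hP M by metis+
    from not_overlapping[OF valid state _ this] h(4) have "e h \<le> start S (Test h') \<or> e h' \<le> start S (Test h)"
      by (auto simp: e_def)
    then show False using P(4) hP by (fastforce simp: P_def)
  qed
  moreover have "f ` J \<subseteq> J - {j'}" using f by auto
  moreover have "finite J" using finP by (simp add: J_def)
  ultimately have "card J \<le> card (J - {j'})" by (intro card_inj_on_le) auto
  moreover have "j' \<in> J" using j'P by (simp add: J_def)
  ultimately show False using card_Diff1_less[OF \<open>finite J\<close>, of j'] by simp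
qed

lemma delay_covering:
  fixes b e x :: real
  assumes "0 \<le> b" "b \<le> e" "e \<le> x" and K: "K \<subseteq> dom S"
    and cover: "\<And>\<tau> i. \<tau> \<in> {0..<b} \<union> {e..<x} \<Longrightarrow> i < m \<Longrightarrow>
      \<exists>k s. k \<in> K \<and> S k = Some (s, i) \<and> s \<le> \<tau> \<and> \<tau> < s + duration I k"
  shows "m * (b + (x - e)) \<le> sum (duration I) K"
proof -
  have fin: "finite K" using K complete finite_all_tasks finite_subset by metis
  have dur: "0 \<le> duration I k" if "k \<in> K" for k
    using that K complete by (intro duration_nonneg[OF valid]) (auto simp: all_tasks_def)
  have "m * (b + (x - e)) = (\<Sum>i<m. b + (x - e))" by simp
  also have "\<dots> \<le> (\<Sum>i<m. sum (duration I) {k \<in> K. machine S k = i})"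
  proof (intro sum_mono covering_length[where s = "start S"])
    fix i \<tau> assume "i \<in> {..<m}" "\<tau> \<in> {0..<b} \<union> {e..<x}"
    then obtain k s where "k \<in> K" "S k = Some (s, i)" "s \<le> \<tau>" "\<tau> < s + duration I k"
      using cover by blast
    then show "\<exists>k\<in>{k \<in> K. machine S k = i}. start S k \<le> \<tau> \<and> \<tau> < start S k + duration I k"
      by (auto simp: start_def machine_def intro!: bexI[of _ k])
  qed (use fin dur assms in auto)
  also have "\<dots> = sum (duration I) K"
    using fin K complete task_started(3) by (intro sum.group) auto
  finally show ?thesis .
qed

text \<open>The left-hand difference is the time during which \<open>j\<close> neither runs nor is
  tested but waits. All \<open>m\<close> machines are then busy with tasks of other jobs that
  precede the final task of \<open>j\<close>.\<close>

lemma completion_bound: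
  assumes j: "j < num_jobs I"
  shows "m * (completion_time I S j - work I S j) \<le> (\<Sum>h\<in>{..<num_jobs I} - {j}. delay \<alpha> \<beta> I S h j)"
proof -
  define K where "K = {k \<in> dom S. job_of k \<noteq> j \<and> precedes \<beta> I k (final_task \<alpha> I j)}"
  have runs: "runs_untested S j \<or> runs_tested I S j"
    using feasible_schedule j by (auto simp: feasible_def)
  have "m * (completion_time I S j - work I S j) \<le> sum (duration I) K"
  proof (cases "to_test \<alpha> I j")
    case False
    let ?k = "Exec_Untested j"
    have k: "?k \<in> all_tasks \<alpha> I" using False j by (simp add: all_tasks_def)
    note st = task_started[OF k]
    have only: "l = ?k" if "l \<in> dom S" "job_of l = j" for l
      using that False unfolding complete by (cases l) (auto simp: all_tasks_def)
    have "runs_untested S j" using runs st(1) by (auto simp: runs_tested_def)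
    then have "completion_time I S j - work I S j = start S ?k"
      unfolding completion_time_def by (subst st(1)) (simp add: work_def job_tasks_untested)
    \<comment> \<open>With \<open>e = x\<close> the second waiting phase is empty.\<close>
    moreover have "m * (start S ?k + (start S ?k - start S ?k)) \<le> sum (duration I) K"
    proof (rule delay_covering)
      fix \<tau> i assume \<tau>: "\<tau> \<in> {0..<start S ?k} \<union> {start S ?k..<start S ?k}" and i: "i < m"
      have wait: "waiting \<alpha> I S ?k t" if "0 \<le> t" "t < start S ?k" for t
        using that st(1) False j by (auto simp: waiting_def released_def)
      obtain l s where l: "S l = Some (s, i)" "s \<le> \<tau>" "\<tau> < s + duration I l"
        using waiting_busy[OF valid state wait[of \<tau>] _ i] \<tau> st(2) by (auto simp: busy_def)
      have "s < start S ?k" using l \<tau> by auto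
      then have "precedes \<beta> I l ?k" "l \<noteq> ?k"
        using waiting_precedes[OF valid state wait l(1)] started(4)[OF valid state l(1)] l(1)
        by (auto simp: start_def)
      then have "l \<in> K" using l only by (auto simp: K_def final_task_def False)
      with l show "\<exists>l s. l \<in> K \<and> S l = Some (s, i) \<and> s \<le> \<tau> \<and> \<tau> < s + duration I l" by blast
    qed (use st in \<open>auto simp: K_def\<close>)
    ultimately show ?thesis by simp
  next
    case True
    let ?T = "Test j" and ?E = "Exec_Tested j"
    define b where "b = start S ?T"
    define e where "e = b + test_time I j"
    define x where "x = start S ?E"
    note tasks = tested_tasks[OF j True]
    have ST: "S ?T = Some (b, machine S ?T)" "b \<le> now" "0 \<le> b"
      and SE: "S ?E = Some (x, machine S ?E)" "x \<le> now"
      unfolding b_def x_def using task_started tasks by auto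
    have t: "0 \<le> test_time I j" using valid j by (simp add: valid_problem_def)
    have order: "b \<le> e" "e \<le> x" using tasks(3) t by (auto simp: b_def e_def x_def)
    have only: "l = ?T \<or> l = ?E" if "l \<in> dom S" "job_of l = j" for l
      using that True unfolding complete by (cases l) (auto simp: all_tasks_def)
    have tested: "runs_tested I S j" using runs ST(1) by (auto simp: runs_untested_def)
    then have "completion_time I S j - work I S j = b + (x - e)"
      using SE(1) job_tasks_tested[OF tested]
      by (simp add: completion_time_def work_def e_def runs_tested_def)
    moreover have "m * (b + (x - e)) \<le> sum (duration I) K"
    proof (rule delay_covering)
      fix \<tau> i assume \<tau>: "\<tau> \<in> {0..<b} \<union> {e..<x}" and i: "i < m"
      have waitT: "waiting \<alpha> I S ?T t" if "0 \<le> t" "t < b" for t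
        using that ST(1) released_tested[OF j True] by (auto simp: waiting_def)
      have waitE: "waiting \<alpha> I S ?E t" if "e \<le> t" "t < x" for t
        using that SE(1) released_tested[OF j True] by (auto simp: waiting_def e_def b_def)
      have "busy I S i \<tau>"
        using \<tau> waiting_busy[OF valid state waitT[of \<tau>] _ i] waiting_busy[OF valid state waitE[of \<tau>] _ i]
          ST(2) SE(2) by auto
      then obtain l s where l: "S l = Some (s, i)" "s \<le> \<tau>" "\<tau> < s + duration I l"
        by (auto simp: busy_def)
      have "l \<noteq> ?T" using l \<tau> ST(1) order by (auto simp: e_def)
      moreover have "l \<noteq> ?E" using l \<tau> SE(1) order by auto
      \<comment> \<open>If \<open>l\<close> starts before \<open>b\<close> or from \<open>e\<close>
        on, a task of \<open>j\<close> is waiting at that moment. If \<open>l\<close> starts during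
        the test, \<open>exec_immediate\<close> applies: were \<open>l\<close> not to precede
        \<open>?E\<close>, the execution would start at \<open>e\<close> and there would be no
        second phase.\<close>
      moreover have "precedes \<beta> I l ?E"
      proof (cases "s < b")
        case True
        then have "precedes \<beta> I l ?T"
          using waiting_precedes[OF valid state waitT l(1)] started(4)[OF valid state l(1)] by blast
        then show ?thesis using precedes_trans[OF _ precedes_Test_Exec] by blast
      next
        case False
        then have "e \<le> \<tau>" "\<tau> < x" using \<tau> l(2) by auto
        show ?thesis
        proof (cases "s < e")
          case True
          with exec_immediate[OF l(1) j \<open>to_test \<alpha> I j\<close>] \<open>e \<le> \<tau>\<close> \<open>\<tau> < x\<close> show ?thesis
            by (auto simp: e_def b_def x_def)
        next
          case False
          with waiting_precedes[OF valid state waitE l(1)] l(2) \<open>\<tau> < x\<close> show ?thesis by simp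
        qed
      qed
      ultimately have "l \<in> K" using l only by (auto simp: K_def final_task_def True)
      with l show "\<exists>l s. l \<in> K \<and> S l = Some (s, i) \<and> s \<le> \<tau> \<and> \<tau> < s + duration I l" by blast
    qed (use ST order in \<open>auto simp: K_def\<close>)
    ultimately show ?thesis by simp
  qed
  also have "\<dots> = (\<Sum>h\<in>{..<num_jobs I} - {j}. delay \<alpha> \<beta> I S h j)"
  proof -
    have "finite K" using complete finite_all_tasks by (auto simp: K_def)
    moreover have "job_of ` K \<subseteq> {..<num_jobs I} - {j}"
      unfolding K_def complete by (auto simp: all_tasks_def)
    ultimately have "sum (duration I) K =
        (\<Sum>h\<in>{..<num_jobs I} - {j}. sum (duration I) {k \<in> K. job_of k = h})"
      by (intro sum.group[symmetric]) auto
    moreover have "{k \<in> K. job_of k = h} =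
        {k \<in> job_tasks S h. precedes \<beta> I k (final_task \<alpha> I j)}" if "h \<noteq> j" for h
      using that by (auto simp: K_def job_tasks_def)
    ultimately show ?thesis by (simp add: delay_def)
  qed
  finally show ?thesis .
qed

lemma job_tasks_eq:
  assumes "j < num_jobs I"
  shows "job_tasks S j = (if to_test \<alpha> I j then {Test j, Exec_Tested j} else {Exec_Untested j})"
proof (rule set_eqI)
  fix k
  show "k \<in> job_tasks S j \<longleftrightarrow>
      k \<in> (if to_test \<alpha> I j then {Test j, Exec_Tested j} else {Exec_Untested j})"
    unfolding job_tasks_def complete using assms by (cases k) (auto simp: all_tasks_def)
qed

lemma delay_first:
  assumes j: "j < num_jobs I" and first: "precedes \<beta> I (final_task \<alpha> I j) (final_task \<alpha> I h)"
  shows "delay \<alpha> \<beta> I S j h = work I S j"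
proof -
  have "precedes \<beta> I k (final_task \<alpha> I h)" if "k \<in> job_tasks S j" for k
    using that first precedes_trans[OF precedes_Test_Exec]
    by (auto simp: job_tasks_eq[OF j] final_task_def split: if_splits)
  then have "{k \<in> job_tasks S j. precedes \<beta> I k (final_task \<alpha> I h)} = job_tasks S j" by blast
  then show ?thesis by (simp add: delay_def work_def)
qed

text \<open>The tie-break by job index makes the order of the two final tasks strict, so only the
  test of \<open>h\<close> can come before the final task of \<open>j\<close>.\<close>

lemma delay_second:
  assumes h: "h < num_jobs I" and "h \<noteq> j"
    and first: "precedes \<beta> I (final_task \<alpha> I j) (final_task \<alpha> I h)"
  shows "delay \<alpha> \<beta> I S h j =
    (if to_test \<alpha> I h \<and> precedes \<beta> I (Test h) (final_task \<alpha> I j) then test_time I h else 0)"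
proof -
  have "\<not> precedes \<beta> I (final_task \<alpha> I h) (final_task \<alpha> I j)"
    using first \<open>h \<noteq> j\<close> by (auto simp: precedes_def)
  then have "{k \<in> job_tasks S h. precedes \<beta> I k (final_task \<alpha> I j)} =
    (if to_test \<alpha> I h \<and> precedes \<beta> I (Test h) (final_task \<alpha> I j) then {Test h} else {})"
    by (auto simp: job_tasks_eq[OF h] final_task_def[of \<alpha> I h] split: if_splits)
  then show ?thesis by (simp add: delay_def)
qed

lemma work_eq:
  assumes "j < num_jobs I"
  shows "work I S j = (if to_test \<alpha> I j then test_time I j + proc_time I j else upper_limit I j)"
  by (simp add: work_def job_tasks_eq[OF assms])

end

section \<open>Mutual delays and the resulting cost bound\<close>

lemma untested_bound:
  fixes \<alpha> t p u :: real
  assumes "\<alpha> \<ge> 1" "0 \<le> p" "0 \<le> u" "u \<le> \<alpha> * t"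
  shows "u \<le> \<alpha> * min u (t + p)"
proof -
  have "1 * u \<le> \<alpha> * u" using assms by (intro mult_right_mono) auto
  moreover have "u \<le> \<alpha> * (t + p)"
    by (rule order_trans[OF assms(4) mult_left_mono]) (use assms in auto)
  ultimately show ?thesis using assms by (auto simp: min_def)
qed

text \<open>The two arguments of \<open>max\<close> serve the two arguments of \<open>min\<close>:
  \<open>c * t + p \<le> c * (t + p)\<close>, and \<open>t \<le> u / \<alpha>\<close> together with
  \<open>p \<le> u\<close>. The case \<open>c = 1\<close> bounds the time spent on a job,
  \<open>c = 2\<close> a job together with a second test that is no longer than its own.\<close>

lemma tested_bound:
  fixes \<alpha> t p u c :: real
  assumes "\<alpha> \<ge> 1" "0 \<le> t" "0 \<le> p" "p \<le> u" "\<alpha> * t < u" and c: "c \<ge> 1"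
  shows "c * t + p \<le> max c (1 + c / \<alpha>) * min u (t + p)"
proof -
  have "c * t + p \<le> c * (t + p)" using assms mult_right_mono[of 1 c p] by (simp add: algebra_simps)
  also have "\<dots> \<le> max c (1 + c / \<alpha>) * (t + p)" using assms by (intro mult_right_mono) auto
  finally have 1: "c * t + p \<le> max c (1 + c / \<alpha>) * (t + p)" .
  have "t \<le> u / \<alpha>" using assms by (simp add: field_simps)
  then have "c * t \<le> c * (u / \<alpha>)" using c by (intro mult_left_mono) auto
  then have "c * t + p \<le> (1 + c / \<alpha>) * u" using assms by (simp add: algebra_simps)
  also have "\<dots> \<le> max c (1 + c / \<alpha>) * u" using assms by (intro mult_right_mono) auto
  finally show ?thesis using 1 by (simp add: min_def)
qed

context
  fixes \<alpha> \<beta> R r :: real and m :: nat and I :: problem and S :: schedule and now :: real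
  assumes \<alpha>: "\<alpha> \<ge> 1" and \<beta>: "\<beta> \<ge> 1"
    and R: "\<alpha> * (1 + 1 / \<beta>) \<le> R" "1 + 1 / \<alpha> + 1 / \<beta> + 1 / (\<alpha> * \<beta>) \<le> R" "\<beta> \<le> R" "2 \<le> R"
      "1 + 2 / \<alpha> \<le> R"
    and r: "r = max \<alpha> (1 + 1 / \<alpha>)"
    and valid: "valid_problem I" and state: "greedy_state \<alpha> \<beta> m I S now"
    and complete: "dom S = all_tasks \<alpha> I"
begin

lemma r_le_R: "r \<le> R"
proof -
  have "\<alpha> * 1 \<le> \<alpha> * (1 + 1 / \<beta>)" using \<alpha> \<beta> by (intro mult_left_mono) auto
  moreover have "1 / \<alpha> \<le> 2 / \<alpha>" using \<alpha> by (intro divide_right_mono) auto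
  ultimately show ?thesis using R unfolding r by simp
qed

lemma job_values:
  assumes "j < num_jobs I"
  shows "0 \<le> test_time I j" "0 \<le> proc_time I j" "0 \<le> upper_limit I j"
    "proc_time I j \<le> upper_limit I j" "0 \<le> opt_time I j"
  using assms valid by (auto simp: valid_problem_def opt_time_def)

lemma untested_le:
  assumes "j < num_jobs I" "\<not> to_test \<alpha> I j"
  shows "upper_limit I j \<le> \<alpha> * opt_time I j"
  unfolding opt_time_def using job_values[OF assms(1)] assms(2) \<alpha>
  by (intro untested_bound) (auto simp: to_test_def)

lemma tested_le:
  assumes "j < num_jobs I" "to_test \<alpha> I j"
  shows "test_time I j + proc_time I j \<le> (1 + 1 / \<alpha>) * opt_time I j"
    "2 * test_time I j + proc_time I j \<le> R * opt_time I j" "test_time I j \<le> opt_time I j"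
proof -
  note v = job_values[OF assms(1)]
  have t: "\<alpha> * test_time I j < upper_limit I j" using assms(2) by (simp add: to_test_def)
  show "test_time I j + proc_time I j \<le> (1 + 1 / \<alpha>) * opt_time I j"
    using tested_bound[OF \<alpha> v(1,2,4) t, of 1] \<alpha> by (simp add: opt_time_def max_def)
  have "2 * test_time I j + proc_time I j \<le> max 2 (1 + 2 / \<alpha>) * opt_time I j"
    using tested_bound[OF \<alpha> v(1,2,4) t, of 2] by (simp add: opt_time_def)
  also have "\<dots> \<le> R * opt_time I j" using R v by (intro mult_right_mono) auto
  finally show "2 * test_time I j + proc_time I j \<le> R * opt_time I j" .
  have "1 * test_time I j \<le> \<alpha> * test_time I j" using \<alpha> v by (intro mult_right_mono) auto
  with t v show "test_time I j \<le> opt_time I j" by (simp add: opt_time_def)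
qed

lemma work_le:
  assumes "j < num_jobs I" shows "work I S j \<le> r * opt_time I j"
proof -
  have "\<alpha> * opt_time I j \<le> r * opt_time I j" "(1 + 1 / \<alpha>) * opt_time I j \<le> r * opt_time I j"
    using job_values[OF assms] by (auto simp: r intro!: mult_right_mono)
  then show ?thesis
    using untested_le[OF assms] tested_le(1)[OF assms] work_eq[OF valid state complete assms] by auto
qed

text \<open>The earlier job \<open>j\<close> delays \<open>h\<close> by its whole work, whereas
  \<open>h\<close> delays \<open>j\<close> at most by its test. The terms in the maximum defining
  \<open>R\<close> pay for the cases below.\<close>

lemma mutual_delay_ordered:
  assumes j: "j < num_jobs I" and h: "h < num_jobs I" and "h \<noteq> j"
    and first: "precedes \<beta> I (final_task \<alpha> I j) (final_task \<alpha> I h)"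
  shows "delay \<alpha> \<beta> I S j h + delay \<alpha> \<beta> I S h j \<le> R * min (opt_time I j) (opt_time I h)"
proof -
  define w where "w k = weight \<beta> I (final_task \<alpha> I k)" for k
  note Wj = work_eq[OF valid state complete j]
  have le_R: "c * opt_time I k \<le> R * opt_time I k" if "c \<le> R" "k < num_jobs I" for c k
    using that job_values by (intro mult_right_mono) auto
  have W_w: "work I S j \<le> w j" using Wj by (auto simp: w_def final_task_def)
  have w: "w j \<le> w h" using first by (auto simp: w_def precedes_def)
  have sum: "delay \<alpha> \<beta> I S j h + delay \<alpha> \<beta> I S h j = work I S j +
      (if to_test \<alpha> I h \<and> precedes \<beta> I (Test h) (final_task \<alpha> I j) then test_time I h else 0)"
    using delay_first[OF valid state complete j first]
      delay_second[OF valid state complete h \<open>h \<noteq> j\<close> first] by simp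
  have "delay \<alpha> \<beta> I S j h + delay \<alpha> \<beta> I S h j \<le> R * opt_time I j \<and>
    delay \<alpha> \<beta> I S j h + delay \<alpha> \<beta> I S h j \<le> R * opt_time I h"
  proof (cases "to_test \<alpha> I h \<and> precedes \<beta> I (Test h) (final_task \<alpha> I j)")
    case False
    \<comment> \<open>If \<open>h\<close> is tested, its test does not precede the final task of
      \<open>j\<close>, which therefore weighs at most \<open>\<beta> * test_time I h\<close>;
      otherwise the weight of \<open>h\<close> is its upper limit.\<close>
    have "work I S j \<le> R * opt_time I h"
    proof (cases "to_test \<alpha> I h")
      case True
      with False have "w j \<le> \<beta> * test_time I h"
        by (auto simp: w_def precedes_def)
      also have "\<dots> \<le> \<beta> * opt_time I h"
        using tested_le(3)[OF h True] \<beta> by (intro mult_left_mono) auto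
      also have "\<dots> \<le> R * opt_time I h" using R(3) h by (rule le_R)
      finally show ?thesis using W_w by simp
    next
      case False
      then have "work I S j \<le> \<alpha> * opt_time I h"
        using W_w w untested_le[OF h] by (simp add: w_def final_task_def)
      also have "\<dots> \<le> R * opt_time I h" using r_le_R h by (intro le_R) (simp_all add: r)
      finally show ?thesis .
    qed
    moreover have "work I S j \<le> R * opt_time I j"
      using work_le[OF j] le_R[OF r_le_R j] by simp
    ultimately show ?thesis using False sum by auto
  next
    case True
    have tw: "\<beta> * test_time I h \<le> w j" using True by (auto simp: w_def precedes_def)
    then have t_w: "test_time I h \<le> w j / \<beta>" using \<beta> by (simp add: field_simps)
    \<comment> \<open>Otherwise the execution of \<open>h\<close> would have the weight of its test
      and precede the final task of \<open>j\<close> as well.\<close>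
    have "w h \<noteq> \<beta> * test_time I h"
    proof
      assume "w h = \<beta> * test_time I h"
      with True have "precedes \<beta> I (final_task \<alpha> I h) (final_task \<alpha> I j)"
        by (simp add: w_def precedes_def)
      with first \<open>h \<noteq> j\<close> show False by (auto simp: precedes_def)
    qed
    then have "w h = test_time I h + proc_time I h"
      using True by (auto simp: w_def final_task_def max_def split: if_splits)
    then have "work I S j + test_time I h \<le> R * opt_time I h"
      using W_w w tested_le(2)[OF h] True by simp
    \<comment> \<open>The test of \<open>h\<close> is at most a fraction \<open>1 / \<beta>\<close>
      of \<open>w j\<close>. This yields the factor \<open>1 + 1 / \<beta>\<close>, unless
      \<open>w j\<close> is the weight of the test of \<open>j\<close>; in that case the test of
      \<open>h\<close> is no longer than that of \<open>j\<close>.\<close>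
    moreover have "work I S j + test_time I h \<le> R * opt_time I j"
    proof (cases "to_test \<alpha> I j")
      case False
      then have "w j = upper_limit I j" by (simp add: w_def final_task_def)
      then have "work I S j + test_time I h \<le> (1 + 1 / \<beta>) * upper_limit I j"
        using W_w t_w by (simp add: algebra_simps)
      also have "\<dots> \<le> (1 + 1 / \<beta>) * (\<alpha> * opt_time I j)"
        using untested_le[OF j False] \<beta> by (intro mult_left_mono) auto
      also have "\<dots> = \<alpha> * (1 + 1 / \<beta>) * opt_time I j" by simp
      also have "\<dots> \<le> R * opt_time I j" using R(1) j by (rule le_R)
      finally show ?thesis .
    next
      case True
      note t = tested_le[OF j True]
      show ?thesis
      proof (cases "w j = \<beta> * test_time I j")
        case True
        with tw \<beta> have "test_time I h \<le> test_time I j" by simp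
        with Wj \<open>to_test \<alpha> I j\<close> t(2) show ?thesis by simp
      next
        case False
        with True have "w j = test_time I j + proc_time I j"
          by (auto simp: w_def final_task_def max_def split: if_splits)
        then have "work I S j + test_time I h \<le> (1 + 1 / \<beta>) * (test_time I j + proc_time I j)"
          using W_w t_w by (simp add: algebra_simps add_divide_distrib)
        also have "\<dots> \<le> (1 + 1 / \<beta>) * ((1 + 1 / \<alpha>) * opt_time I j)"
          using t(1) \<beta> by (intro mult_left_mono) auto
        also have "\<dots> = (1 + 1 / \<alpha> + 1 / \<beta> + 1 / (\<alpha> * \<beta>)) * opt_time I j"
          by (simp add: algebra_simps add_divide_distrib)
        also have "\<dots> \<le> R * opt_time I j" using R(2) j by (rule le_R)
        finally show ?thesis .
      qed
    qed
    ultimately show ?thesis using True sum by simp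
  qed
  then show ?thesis by (simp add: min_def)
qed

lemma mutual_delay:
  assumes "j < num_jobs I" "h < num_jobs I" "h \<noteq> j"
  shows "delay \<alpha> \<beta> I S j h + delay \<alpha> \<beta> I S h j \<le> R * min (opt_time I j) (opt_time I h)"
proof (cases "precedes \<beta> I (final_task \<alpha> I j) (final_task \<alpha> I h)")
  case False
  then show ?thesis
    using mutual_delay_ordered[of h j] precedes_total assms by (simp add: min.commute add.commute)
qed (use mutual_delay_ordered assms in blast)

text \<open>Summing \<open>completion_bound\<close> over all jobs counts each delay once.
  Symmetrizing pairs the two delays between any two jobs, which halves \<open>R\<close>, and
  removing the diagonal subtracts \<open>sum q N\<close>.\<close>

lemma cost_upper_bound:
  assumes m: "m \<ge> 1"
  defines "q \<equiv> opt_time I" and "N \<equiv> {..<num_jobs I}"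
  shows "cost I S \<le> R / (2 * m) * ((\<Sum>i\<in>N. \<Sum>j\<in>N. min (q i) (q j)) - sum q N) + r * sum q N"
proof -
  let ?d = "delay \<alpha> \<beta> I S"
  have split: "(\<Sum>j\<in>N. \<Sum>h\<in>N. f h j) = (\<Sum>j\<in>N. \<Sum>h\<in>N - {j}. f h j) + (\<Sum>j\<in>N. f j j)"
    for f :: "nat \<Rightarrow> nat \<Rightarrow> real"
  proof -
    have "(\<Sum>h\<in>N. f h j) = (\<Sum>h\<in>N - {j}. f h j) + f j j" if "j \<in> N" for j
      using that by (simp add: N_def sum.remove[of "{..<num_jobs I}" j])
    then show ?thesis by (simp add: sum.distrib)
  qed
  have swap: "(\<Sum>j\<in>N. \<Sum>h\<in>N - {j}. ?d h j) = (\<Sum>j\<in>N. \<Sum>h\<in>N - {j}. ?d j h)"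
    using split[of ?d] split[of "\<lambda>h j. ?d j h"] sum.swap[of ?d N N] by simp
  have "2 * (\<Sum>j\<in>N. \<Sum>h\<in>N - {j}. ?d h j) = (\<Sum>j\<in>N. \<Sum>h\<in>N - {j}. ?d j h + ?d h j)"
    using swap by (simp add: sum.distrib)
  also have "\<dots> \<le> (\<Sum>j\<in>N. \<Sum>h\<in>N - {j}. R * min (q h) (q j))"
    unfolding q_def N_def using mutual_delay by (intro sum_mono) (auto simp: min.commute)
  also have "\<dots> = R * ((\<Sum>j\<in>N. \<Sum>h\<in>N. min (q h) (q j)) - sum q N)"
    using split[of "\<lambda>h j. min (q h) (q j)"] by (simp add: sum_distrib_left)
  finally have pairs: "2 * (\<Sum>j\<in>N. \<Sum>h\<in>N - {j}. ?d h j) \<le>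
    R * ((\<Sum>i\<in>N. \<Sum>j\<in>N. min (q i) (q j)) - sum q N)"
    by (simp add: min.commute)
  have "m * (cost I S - sum (work I S) N) = (\<Sum>j\<in>N. m * (completion_time I S j - work I S j))"
    by (simp add: cost_def N_def sum_subtractf sum_distrib_left right_diff_distrib)
  also have "\<dots> \<le> (\<Sum>j\<in>N. \<Sum>h\<in>N - {j}. ?d h j)"
    unfolding N_def using completion_bound[OF valid state complete] by (intro sum_mono) auto
  finally have "2 * m * (cost I S - sum (work I S) N) \<le>
    R * ((\<Sum>i\<in>N. \<Sum>j\<in>N. min (q i) (q j)) - sum q N)"
    using pairs by simp
  then have "cost I S - sum (work I S) N \<le>
    R / (2 * m) * ((\<Sum>i\<in>N. \<Sum>j\<in>N. min (q i) (q j)) - sum q N)"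
    using m by (simp add: field_simps)
  moreover have "sum (work I S) N \<le> r * sum q N"
    unfolding sum_distrib_left using work_le by (intro sum_mono) (auto simp: N_def q_def)
  ultimately show ?thesis by simp
qed

lemma cost_le_feasible:
  assumes m: "m \<ge> 1" and Rr: "R \<le> 2 * r" and S': "feasible m I S'"
  shows "cost I S \<le> (R * (1 / 2 + 1 / (2 * real m)) + r * (1 - 1 / real m)) * cost I S'"
proof -
  define q where "q = opt_time I"
  define Q where "Q = sum q {..<num_jobs I}"
  define M where "M = (\<Sum>i<num_jobs I. \<Sum>j<num_jobs I. min (q i) (q j))"
  define a where "a = 1 / real m"
  have a: "0 \<le> a" "a \<le> 1" using m by (auto simp: a_def)
  have R0: "0 \<le> R" using R by simp
  have lower: "a * M + Q \<le> 2 * cost I S'" "Q \<le> cost I S'"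
    using cost_lower_bound[OF valid S' m] by (simp_all add: M_def Q_def q_def a_def)
  have Q0: "0 \<le> Q" unfolding Q_def q_def using job_values(5) by (intro sum_nonneg) auto
  have "cost I S \<le> R / (2 * m) * (M - Q) + r * Q"
    using cost_upper_bound[OF m] by (simp add: M_def Q_def q_def)
  also have "R / (2 * m) * (M - Q) = R / 2 * (a * M - a * Q)"
    using m by (simp add: a_def field_simps)
  finally have "cost I S \<le> R / 2 * (a * M - a * Q) + r * Q" .
  also have "\<dots> \<le> R / 2 * (2 * cost I S' - Q - a * Q) + r * Q"
    using lower R0 by (intro add_right_mono mult_left_mono) auto
  also have "\<dots> = R * cost I S' + (1 - a) * (r - R / 2) * Q - a * (R - r) * Q"
    by (simp add: field_simps)
  \<comment> \<open>Here \<open>R \<le> 2 * r\<close> enters: it makes the coefficient of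
    \<open>Q\<close> nonnegative, so that \<open>Q\<close> may be replaced by the cost of
    \<open>S'\<close>.\<close>
  also have "\<dots> \<le> R * cost I S' + (1 - a) * (r - R / 2) * cost I S'"
  proof -
    have 1: "0 \<le> a * (R - r) * Q" using a r_le_R Q0 by simp
    have 2: "(1 - a) * (r - R / 2) * Q \<le> (1 - a) * (r - R / 2) * cost I S'"
      using a Rr lower by (intro mult_left_mono) auto
    from add_left_mono[OF diff_mono[OF 2 1], of "R * cost I S'"] show ?thesis
      by (simp only: add_diff_eq diff_zero)
  qed
  also have "\<dots> = (R * (1 / 2 + a / 2) + r * (1 - a)) * cost I S'" by (simp add: field_simps)
  finally show ?thesis by (simp add: a_def mult.commute)
qed

end

theorem theorem19:
  fixes m :: nat and \<alpha> \<beta> R r :: real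
  assumes "m \<ge> 1" and "\<alpha> \<ge> 1" and "\<beta> \<ge> 1"
    and "R = Max {\<alpha> * (1 + 1 / \<beta>), 1 + 1 / \<alpha> + 1 / \<beta> + 1 / (\<alpha> * \<beta>), \<beta>, 2, 1 + 2 / \<alpha>}"
    and "r = max \<alpha> (1 + 1 / \<alpha>)"
    and "R \<le> 2 * r"
  shows "\<exists>A. online_algorithm m A \<and>
    competitive m A (R * (1 / 2 + 1 / (2 * real m)) + r * (1 - 1 / real m))"
proof (intro exI conjI)
  let ?A = "sort_algorithm \<alpha> \<beta> m" and ?c = "R * (1 / 2 + 1 / (2 * real m)) + r * (1 - 1 / real m)"
  have R: "\<alpha> * (1 + 1 / \<beta>) \<le> R" "1 + 1 / \<alpha> + 1 / \<beta> + 1 / (\<alpha> * \<beta>) \<le> R" "\<beta> \<le> R" "2 \<le> R"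
    "1 + 2 / \<alpha> \<le> R"
    unfolding assms(4) by (rule Max_ge; simp)+
  have produced: "\<exists>S now. produces m ?A I S \<and> greedy_state \<alpha> \<beta> m I S now \<and> dom S = all_tasks \<alpha> I"
    if I: "valid_problem I" for I
  proof -
    obtain N S now where S: "run ?A I N = (S, now)" "greedy_state \<alpha> \<beta> m I S now" "dom S = all_tasks \<alpha> I"
      using run_completes[OF I assms(1)] .
    have "produces m ?A I S"
      using complete_feasible[OF I S(2,3)] S(1) by (auto simp: produces_def intro!: exI[of _ N])
    with S show ?thesis by blast
  qed
  then show "online_algorithm m ?A" unfolding online_algorithm_def by blast
  show "competitive m ?A ?c"
    unfolding competitive_def
  proof (intro allI impI)
    fix I S assume I: "valid_problem I" and S: "produces m ?A I S"
    \<comment> \<open>A policy produces at most one schedule, so \<open>S\<close> is the one known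
      to satisfy the invariant.\<close>
    with produced produces_unique obtain now where
      st: "greedy_state \<alpha> \<beta> m I S now" "dom S = all_tasks \<alpha> I" by metis
    have "0 < R * (1 / 2 + 1 / (2 * real m))" using R(4) assms(1) by (intro mult_pos_pos add_pos_pos) auto
    moreover have "0 \<le> r * (1 - 1 / real m)" using assms(1,2,5) by (intro mult_nonneg_nonneg) (auto simp: le_max_iff_disj)
    ultimately have c: "0 < ?c" by simp
    \<comment> \<open>The optimum is an infimum, so the bound is shown against every feasible
      schedule after division by the positive \<open>?c\<close>.\<close>
    have "cost I S / ?c \<le> opt_cost m I"
      unfolding opt_cost_def
    proof (rule cInf_greatest)
      show "{cost I S |S. feasible m I S} \<noteq> {}" using feasible_exists[OF I assms(1)] by auto
      fix v assume "v \<in> {cost I S |S. feasible m I S}"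
      then obtain S' where "feasible m I S'" "v = cost I S'" by blast
      then have "cost I S \<le> ?c * v"
        using cost_le_feasible[OF assms(2,3) R assms(5) I st assms(1,6)] by blast
      with c show "cost I S / ?c \<le> v" by (simp add: pos_divide_le_eq mult.commute)
    qed
    with c show "cost I S \<le> ?c * opt_cost m I" by (simp add: pos_divide_le_eq mult.commute)
  qed
qed

end
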